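(* The generating function $A'(1,y)=\sum_P y^{\mathrm{kiss}(P)}$ of all inchworm paths $P$ with respect to the kissing number is $$A'(1,y)=\frac{1-y+y^2-\sqrt{1-2y-y^2-2y^3+y^4}}{2y^2}.$$
   Context: Consider the hexagonal packing of the plane by circles of radius $2$ with centers $(2+4i+2j,\,2\sqrt3\,j)$, $i,j\in\mathbb Z$; the origin is the tangency point of two horizontally adjacent circles. The tangency points cut every circle into six arcs. Traversed from left to right these give six types of steps (angles measured on the circle carrying the arc): $U$ from $180^\circ$ to $120^\circ$ (displacement $(1,\sqrt3)$), $F$ from $120^\circ$ to $60^\circ$ (displacement $(2,0)$), $D$ from $60^\circ$ to $0^\circ$ (displacement $(1,-\sqrt3)$), $\overline U$ from $300^\circ$ to $360^\circ$ (displacement $(1,\sqrt3)$), $\overline F$ from $240^\circ$ to $300^\circ$ (displacement $(2,0)$), $\overline D$ from $180^\circ$ to $240^\circ$ (displacement $(1,-\sqrt3)$). A path in the packing starts at the origin, is a concatenation of such arcs of circles of the packing, each starting where the previous one ends, and stays in the quarter plane $x,y\ge 0$. Equivalently, it is a word in $\{U,F,D,\overline U,\overline F,\overline D\}$ whose first step (if any) is $U$, in which $U$ or $\overline F$ can only be followed by $F$ or $\overline U$; $F$ or $\overline D$ only by $\overline F$ or $D$; $\overline U$ or $D$ only by $U$ or $\overline D$; and which never goes below ordinate $0$. A packing path is such a path ending on the $x$-axis. The empty path is allowed. The kissing number $\mathrm{kiss}(P)$ of a packing path $P$ is the number of circles of the packing lying below the path (under the path, with center of ordinate $\ge0$, between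 its starting and ending abscissas) that touch it, touching at a single point (a tangency point) included. An inchworm path is a packing path in which neither $\overline U\,\overline D$ nor $DU$ occurs as two consecutive steps. The square root is the formal power series with constant term $1$. *)

theory Defs
  imports
    "HOL-Complex_Analysis.Contour_Integration"
    "HOL-Computational_Algebra.Formal_Power_Series"
    "HOL-Library.Sublist"
begin

text \<open>The plane is identified with the complex numbers; a circle of the packing is represented
  by its centre \<open>c\<close> and equals \<open>sphere c 2\<close>.\<close>

definition packing_centers :: "complex set" where
  "packing_centers =
    {Complex (real_of_int (2 + 4 * i + 2 * j)) (2 * sqrt 3 * real_of_int j) | i j. True}"

datatype step = U | F | D | Ubar | Fbar | Dbar

fun start_angle :: "step \<Rightarrow> real" where
  "start_angle U = pi"
| "start_angle F = 2 * pi / 3"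
| "start_angle D = pi / 3"
| "start_angle Ubar = 5 * pi / 3"
| "start_angle Fbar = 4 * pi / 3"
| "start_angle Dbar = pi"

fun end_angle :: "step \<Rightarrow> real" where
  "end_angle U = 2 * pi / 3"
| "end_angle F = pi / 3"
| "end_angle D = 0"
| "end_angle Ubar = 2 * pi"
| "end_angle Fbar = 5 * pi / 3"
| "end_angle Dbar = 4 * pi / 3"

text \<open>The pair \<open>(c, s)\<close> stands for the arc of type \<open>s\<close> on the circle centred at \<open>c\<close>.
  It is oriented from left to right, hence clockwise for \<open>U\<close>, \<open>F\<close>, \<open>D\<close> and
  counterclockwise for \<open>Ubar\<close>, \<open>Fbar\<close>, \<open>Dbar\<close>.\<close>

definition step_arc :: "complex \<times> step \<Rightarrow> real \<Rightarrow> complex" where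
  "step_arc a = part_circlepath (fst a) 2 (start_angle (snd a)) (end_angle (snd a))"

definition trace :: "(complex \<times> step) list \<Rightarrow> complex set" where
  "trace P = insert 0 (\<Union>a\<in>set P. path_image (step_arc a))"

definition endpoint :: "(complex \<times> step) list \<Rightarrow> complex" where
  "endpoint P = (if P = [] then 0 else pathfinish (step_arc (last P)))"

definition path_in_packing :: "(complex \<times> step) list \<Rightarrow> bool" where
  "path_in_packing P \<longleftrightarrow>
     (\<forall>a\<in>set P. fst a \<in> packing_centers) \<and>
     (P \<noteq> [] \<longrightarrow> pathstart (step_arc (hd P)) = 0) \<and>
     successively (\<lambda>a b. pathfinish (step_arc a) = pathstart (step_arc b)) P \<and>
     trace P \<subseteq> {z. 0 \<le> Re z \<and> 0 \<le> Im z}"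

definition packing_path :: "(complex \<times> step) list \<Rightarrow> bool" where
  "packing_path P \<longleftrightarrow> path_in_packing P \<and> Im (endpoint P) = 0"

text \<open>A path is the graph of a function of the abscissa, so a circle lies below it when no point
  of the circle is above the point of the path with the same abscissa. The abscissa of the centre
  is required to be between those of the origin and of the endpoint.\<close>

definition circle_below :: "complex \<Rightarrow> (complex \<times> step) list \<Rightarrow> bool" where
  "circle_below c P \<longleftrightarrow>
     0 \<le> Im c \<and> 0 \<le> Re c \<and> Re c \<le> Re (endpoint P) \<and>
     (\<forall>z\<in>sphere c 2. \<forall>w\<in>trace P. Re z = Re w \<longrightarrow> Im z \<le> Im w)"

definition kiss :: "(complex \<times> step) list \<Rightarrow> nat" where
  "kiss P = card {c \<in> packing_centers. circle_below c P \<and> sphere c 2 \<inter> trace P \<noteq> {}}"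

definition inchworm_path :: "(complex \<times> step) list \<Rightarrow> bool" where
  "inchworm_path P \<longleftrightarrow> packing_path P \<and>
     \<not> sublist [Ubar, Dbar] (map snd P) \<and> \<not> sublist [D, U] (map snd P)"

definition inchworm_gf :: "real fps" where
  "inchworm_gf = Abs_fps (\<lambda>k. real (card {P. inchworm_path P \<and> kiss P = k}))"

text \<open>\<open>fps_radical root 2\<close> is the square root with constant term 1 of a real power series
  with constant term 1.\<close>

lemma fps_radical_root_2:
  fixes a :: "real fps"
  assumes "fps_nth a 0 = 1"
  shows "fps_radical root 2 a ^ 2 = a" and "fps_nth (fps_radical root 2 a) 0 = 1"
  using power_radical[of a root 1] assms by (simp_all add: numeral_2_eq_2)

end

theory Submission
  imports Defs
begin

text \<open>An inchworm path cannot turn at a tangency point of two horizontally adjacent circles, so it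
  returns to the axis only at its end. Unless empty, it is thus a word of horizontal runs
  \<open>F\<close>, \<open>F Fbar F\<close> and so on, of climbs \<open>Ubar U\<close> and of descents \<open>D Dbar\<close>, that is, a peakless Motzkin
  path framed by \<open>U\<close> and \<open>D\<close>. A circle below the path that touches it does so along an arc \<open>F\<close>, or only
  left of its top where \<open>Ubar\<close> starts, or only right of its top where \<open>Dbar\<close> ends. Hence the kissing
  number is the number of steps \<open>F\<close>, \<open>Ubar\<close>, \<open>Dbar\<close>, which is the length of the Motzkin path, and the
  first-return decomposition gives the quadratic equation \<open>T = 1 + y T + y^2 (T - 1) T\<close>.\<close>

subsection \<open>Words of steps\<close>

text \<open>Points are written in integer coordinates, \<open>(x, y)\<close> standing for the point
  \<open>(x, sqrt 3 * y)\<close>. The displacement of a step is \<open>(dx, dy)\<close>, and \<open>(cx, cy)\<close> leads from its start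
  to the centre of the circle that carries it.\<close>

fun dx :: "step \<Rightarrow> int" where
  "dx U = 1" | "dx F = 2" | "dx D = 1" | "dx Ubar = 1" | "dx Fbar = 2" | "dx Dbar = 1"

fun dy :: "step \<Rightarrow> int" where
  "dy U = 1" | "dy F = 0" | "dy D = -1" | "dy Ubar = 1" | "dy Fbar = 0" | "dy Dbar = -1"

fun cx :: "step \<Rightarrow> int" where
  "cx U = 2" | "cx F = 1" | "cx D = -1" | "cx Ubar = -1" | "cx Fbar = 1" | "cx Dbar = 2"

fun cy :: "step \<Rightarrow> int" where
  "cy U = 0" | "cy F = -1" | "cy D = -1" | "cy Ubar = 1" | "cy Fbar = 1" | "cy Dbar = 0"

text \<open>A centre has coordinates \<open>a = 2 + 4 * i + 2 * j\<close> and
  \<open>b = 2 * j\<close>, so \<open>a - b = 2 + 4 * i\<close>. Stated as congruences, membership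
  in the packing is within reach of \<open>presburger\<close>.\<close>

definition center_lattice :: "int \<Rightarrow> int \<Rightarrow> bool" where
  "center_lattice a b \<longleftrightarrow> even b \<and> (a - b) mod 4 = 2"

lemma center_lattice_iff_dvd: "center_lattice a b \<longleftrightarrow> even b \<and> 4 dvd a - b - 2"
  unfolding center_lattice_def by presburger

text \<open>The tangency points fall into three classes, given by the parity of \<open>y\<close> and
  the residue of \<open>x - y\<close> modulo 4. The class of a point decides which two arcs may
  leave it, so this lemma takes the place of the successor rules for words.\<close>

lemma step_start_phase:
  assumes "center_lattice (x + cx s) (y + cy s)"
  shows "s \<in> {U, Dbar} \<longleftrightarrow> even y \<and> (x - y) mod 4 = 0"
    and "s \<in> {F, Ubar} \<longleftrightarrow> odd y \<and> (x - y) mod 4 = 0"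
    and "s \<in> {D, Fbar} \<longleftrightarrow> odd y \<and> (x - y) mod 4 = 2"
proof -
  \<comment> \<open>The three classes exclude one another, and so do the three pairs of steps; hence
    this disjunction yields all the equivalences.\<close>
  have "even y \<and> (x - y) mod 4 = 0 \<and> s \<in> {U, Dbar} \<or> odd y \<and> (x - y) mod 4 = 0 \<and> s \<in> {F, Ubar} \<or>
    odd y \<and> (x - y) mod 4 = 2 \<and> s \<in> {D, Fbar}"
  proof (cases s)
    case U
    then have "even y \<and> (x - y) mod 4 = 0"
      using assms unfolding center_lattice_def U cx.simps cy.simps by presburger
    then show ?thesis using U by simp
  next
    case F
    then have "odd y \<and> (x - y) mod 4 = 0"
      using assms unfolding center_lattice_def F cx.simps cy.simps by presburger
    then show ?thesis using F by simp
  next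
    case D
    then have "odd y \<and> (x - y) mod 4 = 2"
      using assms unfolding center_lattice_def D cx.simps cy.simps by presburger
    then show ?thesis using D by simp
  next
    case Ubar
    then have "odd y \<and> (x - y) mod 4 = 0"
      using assms unfolding center_lattice_def Ubar cx.simps cy.simps by presburger
    then show ?thesis using Ubar by simp
  next
    case Fbar
    then have "odd y \<and> (x - y) mod 4 = 2"
      using assms unfolding center_lattice_def Fbar cx.simps cy.simps by presburger
    then show ?thesis using Fbar by simp
  next
    case Dbar
    then have "even y \<and> (x - y) mod 4 = 0"
      using assms unfolding center_lattice_def Dbar cx.simps cy.simps by presburger
    then show ?thesis using Dbar by simp
  qed
  then show "s \<in> {U, Dbar} \<longleftrightarrow> even y \<and> (x - y) mod 4 = 0"
    and "s \<in> {F, Ubar} \<longleftrightarrow> odd y \<and> (x - y) mod 4 = 0"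
    and "s \<in> {D, Fbar} \<longleftrightarrow> odd y \<and> (x - y) mod 4 = 2"
    by auto
qed

text \<open>Each step starts where the previous one ends, and asking its centre to lie in the
  packing selects the admissible steps. Heights are tested at vertices only;
  \<open>packing_path_located_iff\<close> shows that the arcs then stay above the axis too.\<close>

fun path_word :: "int \<Rightarrow> int \<Rightarrow> step list \<Rightarrow> bool" where
  "path_word x y [] \<longleftrightarrow> y = 0"
| "path_word x y (s # w) \<longleftrightarrow>
     center_lattice (x + cx s) (y + cy s) \<and> 0 \<le> y + dy s \<and> path_word (x + dx s) (y + dy s) w"

definition smooth :: "step \<Rightarrow> step \<Rightarrow> bool" where
  "smooth s s' \<longleftrightarrow> \<not> (s = Ubar \<and> s' = Dbar) \<and> \<not> (s = D \<and> s' = U)"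

text \<open>Each of these steps accounts for exactly one circle below the path, see \<open>perch\<close>.\<close>

definition perching :: "step \<Rightarrow> bool" where
  "perching s \<longleftrightarrow> s \<in> {F, Ubar, Dbar}"

lemma successively_smooth_iff:
  "successively smooth w \<longleftrightarrow> \<not> sublist [Ubar, Dbar] w \<and> \<not> sublist [D, U] w"
proof (induction w)
  case (Cons s w)
  then show ?case
    by (cases w) (auto simp: sublist_Cons_right smooth_def successively_Cons)
qed auto

subsection \<open>Inchworm words and peakless Motzkin paths\<close>

text \<open>A tree stands for a nonempty peakless Motzkin path, decomposed according to its first step and,
  if that step goes up, to the first return. Whether a remainder follows is part of the constructor.\<close>

datatype mot = Pt | Flat mot | Cap mot | Arch mot mot

fun weight :: "mot \<Rightarrow> nat" where
  "weight Pt = 1"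
| "weight (Flat t) = 1 + weight t"
| "weight (Cap a) = 2 + weight a"
| "weight (Arch a t) = 2 + weight a + weight t"

text \<open>\<open>Fbar\<close> joins a first piece to the remainder. The inside of an arch is a
  nonempty tree because \<open>U\<close> leads to a vertex from which only \<open>F\<close> and
  \<open>Ubar\<close> can start, never \<open>D\<close>.\<close>

fun body :: "mot \<Rightarrow> step list" where
  "body Pt = [F]"
| "body (Flat t) = F # Fbar # body t"
| "body (Cap a) = Ubar # U # body a @ [D, Dbar]"
| "body (Arch a t) = Ubar # U # body a @ [D, Dbar, Fbar] @ body t"

text \<open>Only \<open>Fbar\<close> can continue a body, so its end is recognizable in front of a
  tail that does not begin with \<open>Fbar\<close>. Tails are carried along because the inside of
  an arch is followed by \<open>D\<close>.\<close>

lemma body_append_inject: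
  assumes "body t @ r = body t' @ r'"
    and "r = [] \<or> hd r \<noteq> Fbar" "r' = [] \<or> hd r' \<noteq> Fbar"
  shows "t = t' \<and> r = r'"
  using assms
proof (induction t arbitrary: t' r r')
  case Pt then show ?case by (cases t') auto
next
  case (Flat t)
  show ?case
  proof (cases t')
    case Pt then show ?thesis using Flat.prems by auto
  next
    case (Flat t2) then show ?thesis using Flat.prems Flat.IH[of r t2 r'] by auto
  qed (use Flat.prems in auto)
next
  case (Cap a)
  show ?case
  proof (cases t')
    case (Cap a')
    then show ?thesis using Cap.prems Cap.IH[of "D # Dbar # r" a' "D # Dbar # r'"] by auto
  next
    \<comment> \<open>Equal insides would leave \<open>r\<close> beginning with \<open>Fbar\<close>,
      which is excluded.\<close>
    case (Arch a' t2)
    then show ?thesis using Cap.prems Cap.IH[of "D # Dbar # r" a' "D # Dbar # Fbar # body t2 @ r'"] by auto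
  qed (use Cap.prems in auto)
next
  case (Arch a t)
  show ?case
  proof (cases t')
    case (Cap a')
    then show ?thesis
      using Arch.prems Arch.IH(1)[of "D # Dbar # Fbar # body t @ r" a' "D # Dbar # r'"] by auto
  next
    case (Arch a' t2)
    then show ?thesis using Arch.prems Arch.IH(2)[of r t2 r']
      Arch.IH(1)[of "D # Dbar # Fbar # body t @ r" a' "D # Dbar # Fbar # body t2 @ r'"] by auto
  qed (use Arch.prems in auto)
qed

definition mot_word :: "mot \<Rightarrow> step list" where
  "mot_word t = U # body t @ [D]"

lemma inj_mot_word: "inj mot_word"
  using body_append_inject[of _ "[D]" _ "[D]"] by (auto simp: inj_def mot_word_def)

section \<open>Counting trees by weight\<close>

lemma weight_nonzero [simp]: "weight t \<noteq> 0"
  by (induction t) auto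

lemma weight_level_0: "{t. weight t = 0} = {}"
  by simp

lemma weight_level_Suc_0: "{t. weight t = Suc 0} = {Pt}"
proof -
  have "weight t = Suc 0 \<Longrightarrow> t = Pt" for t
    by (cases t) auto
  then show ?thesis by auto
qed

lemma weight_level_Suc_Suc:
  "{t. weight t = Suc (Suc n)} =
     Flat ` {t. weight t = Suc n} \<union> Cap ` {t. weight t = n} \<union>
     (\<lambda>(a, t). Arch a t) ` (\<Union>i\<le>n. {a. weight a = i} \<times> {t. weight t = n - i})"
proof -
  have "(\<exists>a. t = Flat a \<and> weight a = Suc n) \<or> (\<exists>a. t = Cap a \<and> weight a = n) \<or>
    (\<exists>a t'. t = Arch a t' \<and> weight a \<le> n \<and> weight t' = n - weight a)"
    if "weight t = Suc (Suc n)" for t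
    using that by (cases t) auto
  then show ?thesis by (fastforce simp: image_iff)
qed

lemma finite_weight_level: "finite {t. weight t = n}"
proof (induction n rule: less_induct)
  case (less n)
  consider "n = 0" | "n = Suc 0" | m where "n = Suc (Suc m)"
    by (metis not0_implies_Suc)
  then show ?case
  proof cases
    case 3
    then show ?thesis using less
      by (auto simp only: weight_level_Suc_Suc intro!: finite_UnI finite_imageI finite_UN_I finite_cartesian_product)
  qed (auto simp only: weight_level_0 weight_level_Suc_0 intro: finite.intros)
qed

definition mot_gf :: "real fps" where
  "mot_gf = Abs_fps (\<lambda>n. real (card {t. weight t = n}))"

lemma card_weight_level_Suc_Suc:
  "card {t. weight t = Suc (Suc n)} =
     card {t. weight t = Suc n} + card {t. weight t = n} +
     (\<Sum>i\<le>n. card {t. weight t = i} * card {t. weight t = n - i})"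
proof -
  let ?S = "\<lambda>n. {t. weight t = n}"
  have "card ((\<lambda>(a, t). Arch a t) ` (\<Union>i\<le>n. ?S i \<times> ?S (n - i)))
      = card (\<Union>i\<le>n. ?S i \<times> ?S (n - i))"
    by (rule card_image) (auto simp: inj_on_def)
  also have "\<dots> = (\<Sum>i\<le>n. card (?S i \<times> ?S (n - i)))"
    by (rule card_UN_disjoint) (auto simp: finite_weight_level)
  finally have arch: "card ((\<lambda>(a, t). Arch a t) ` (\<Union>i\<le>n. ?S i \<times> ?S (n - i))) =
    (\<Sum>i\<le>n. card (?S i) * card (?S (n - i)))"
    by (simp add: card_cartesian_product)
  have flat: "card (Flat ` ?S (Suc n)) = card (?S (Suc n))" and cap: "card (Cap ` ?S n) = card (?S n)"
    by (rule card_image; simp add: inj_on_def)+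
  have fin: "finite (Flat ` ?S (Suc n))" "finite (Cap ` ?S n)"
    "finite ((\<lambda>(a, t). Arch a t) ` (\<Union>i\<le>n. ?S i \<times> ?S (n - i)))"
    by (auto intro!: finite_imageI finite_UN_I finite_cartesian_product finite_weight_level)
  show ?thesis
    unfolding weight_level_Suc_Suc flat[symmetric] cap[symmetric] arch[symmetric]
    using fin by (subst card_Un_disjoint, simp, simp, force, subst card_Un_disjoint) auto
qed

text \<open>A first step that is level contributes \<open>fps_X\<close>; one that goes up
  contributes, with its matching down step, \<open>fps_X ^ 2\<close> and a nonempty inside. In both
  cases the remainder is empty or a tree, whence the factor \<open>1 + mot_gf\<close>.\<close>

lemma mot_gf_eq: "mot_gf = fps_X * (1 + mot_gf) + fps_X ^ 2 * (mot_gf * (1 + mot_gf))"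
proof (rule fps_ext)
  fix n
  consider "n = 0" | "n = Suc 0" | m where "n = Suc (Suc m)"
    by (metis not0_implies_Suc)
  then show "fps_nth mot_gf n = fps_nth (fps_X * (1 + mot_gf) + fps_X ^ 2 * (mot_gf * (1 + mot_gf))) n"
  proof cases
    case 3
    then show ?thesis
      by (simp add: mot_gf_def card_weight_level_Suc_Suc fps_X_power_mult_nth algebra_simps
          fps_mult_nth[of "Abs_fps _" "Abs_fps _"] atLeast0AtMost)
  qed (simp_all add: mot_gf_def weight_level_0 weight_level_Suc_0 fps_X_power_mult_nth)
qed

lemma gf_closed_form:
  fixes T :: "real fps"
  assumes T: "T = 1 + fps_X * T + fps_X ^ 2 * ((T - 1) * T)"
  shows "T = (1 - fps_X + fps_X ^ 2
         - fps_radical root 2 (1 - 2 * fps_X - fps_X ^ 2 - 2 * fps_X ^ 3 + fps_X ^ 4))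
      / (2 * fps_X ^ 2)"
proof -
  let ?X = "fps_X :: real fps"
  let ?d = "1 - 2 * ?X - ?X ^ 2 - 2 * ?X ^ 3 + ?X ^ 4"
  \<comment> \<open>This completes the square in the quadratic equation for \<open>T\<close>;
    \<open>?d\<close> is its discriminant.\<close>
  define R where "R = 1 - ?X + ?X ^ 2 - 2 * ?X ^ 2 * T"
  have "R ^ 2 = ?d + 4 * ?X ^ 2 * (1 + ?X * T + ?X ^ 2 * ((T - 1) * T) - T)"
    unfolding R_def by algebra
  also have "\<dots> = ?d" using T by simp
  \<comment> \<open>The exponent is written \<open>Suc 1\<close> to match
    \<open>radical_unique\<close>; the constant term 1 of \<open>R\<close> then selects the branch
    of the square root.\<close>
  finally have R2: "R ^ Suc 1 = ?d" by (simp add: numeral_2_eq_2)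
  have R0: "fps_nth R 0 = 1" by (simp add: R_def)
  have d0: "fps_nth ?d 0 = 1" by simp
  have "fps_radical root (Suc 1) ?d = R"
    using radical_unique[of root 1 ?d R] R2 R0 d0 by simp
  then have "(1 - ?X + ?X ^ 2 - fps_radical root 2 ?d) = 2 * ?X ^ 2 * T"
    by (simp add: numeral_2_eq_2 R_def)
  then show ?thesis
    by simp
qed

section \<open>Parsing inchworm words into trees\<close>

lemma path_word_ConsE:
  assumes "path_word x y w" "w \<noteq> []"
  obtains s v where "w = s # v" "center_lattice (x + cx s) (y + cy s)" "0 \<le> y + dy s"
    "path_word (x + dx s) (y + dy s) v"
  using assms by (cases w) auto

lemma path_word_even_phase:
  assumes "path_word x y w" "y \<noteq> 0" "even y" "(x - y) mod 4 = 0"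
  obtains v where "w = U # v" "path_word (x + 1) (y + 1) v"
  | v where "w = Dbar # v" "path_word (x + 1) (y - 1) v" "y > 0"
proof -
  have "w \<noteq> []" using assms by auto
  then obtain s v where s: "w = s # v" "center_lattice (x + cx s) (y + cy s)" "0 \<le> y + dy s"
    "path_word (x + dx s) (y + dy s) v"
    using path_word_ConsE assms(1) by blast
  then have "s \<in> {U, Dbar}" using step_start_phase(1)[OF s(2)] assms by blast
  then show thesis using s that by auto
qed

lemma path_word_odd_phase_0:
  assumes "path_word x y w" "odd y" "(x - y) mod 4 = 0"
  obtains v where "w = F # v" "path_word (x + 2) y v"
  | v where "w = Ubar # v" "path_word (x + 1) (y + 1) v"
proof -
  have "w \<noteq> []" using assms by auto
  then obtain s v where s: "w = s # v" "center_lattice (x + cx s) (y + cy s)" "0 \<le> y + dy s"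
    "path_word (x + dx s) (y + dy s) v"
    using path_word_ConsE assms(1) by blast
  then have "s \<in> {F, Ubar}" using step_start_phase(2)[OF s(2)] assms by blast
  then show thesis using s that by auto
qed

lemma path_word_odd_phase_2:
  assumes "path_word x y w" "odd y" "(x - y) mod 4 = 2"
  obtains v where "w = D # v" "path_word (x + 1) (y - 1) v"
  | v where "w = Fbar # v" "path_word (x + 2) y v"
proof -
  have "w \<noteq> []" using assms by auto
  then obtain s v where s: "w = s # v" "center_lattice (x + cx s) (y + cy s)" "0 \<le> y + dy s"
    "path_word (x + dx s) (y + dy s) v"
    using path_word_ConsE assms(1) by blast
  then have "s \<in> {D, Fbar}" using step_start_phase(3)[OF s(2)] assms by blast
  then show thesis using s that by auto
qed

text \<open>A body returns to its initial height and changes the residue of \<open>x - y\<close>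
  from 0 to 2. Its exact width is not tracked, so the tail is assumed to be admissible from every
  abscissa with that residue.\<close>

lemma path_word_body_append:
  assumes "odd y" "0 < y" "(x - y) mod 4 = 0" "\<And>x'. (x' - y) mod 4 = 2 \<Longrightarrow> path_word x' y r"
  shows "path_word x y (body t @ r)"
  using assms
proof (induction t arbitrary: x y r)
  case Pt
  have "(x + 2 - y) mod 4 = 2" using Pt.prems(3) by presburger
  moreover have "center_lattice (x + 1) (y - 1)" using Pt.prems unfolding center_lattice_def by presburger
  ultimately show ?case using Pt.prems by simp
next
  case (Flat t)
  have "center_lattice (x + 1) (y - 1)" "center_lattice (x + 2 + 1) (y + 1)"
    using Flat.prems unfolding center_lattice_def by presburger+
  moreover have "path_word (x + 2 + 2) y (body t @ r)"
    using Flat.prems by (intro Flat.IH) (simp_all, presburger)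
  ultimately show ?case using Flat.prems by simp
next
  case (Cap a)
  have "center_lattice (x - 1) (y + 1)" "center_lattice (x + 1 + 2) (y + 1)"
    using Cap.prems unfolding center_lattice_def by presburger+
  moreover have up: "odd (y + 1 + 1)" "0 < y + 1 + 1" "(x + 1 + 1 - (y + 1 + 1)) mod 4 = 0"
    using Cap.prems by presburger+
  moreover have "path_word (x + 1 + 1) (y + 1 + 1) (body a @ D # Dbar # r)"
  proof (rule Cap.IH)
    fix x' :: int assume x': "(x' - (y + 1 + 1)) mod 4 = 2"
    have "center_lattice (x' - 1) (y + 1 + 1 - 1)" "center_lattice (x' + 1 + 2) (y + 1)"
      "(x' + 1 + 1 - y) mod 4 = 2"
      using x' Cap.prems unfolding center_lattice_def by presburger+
    then show "path_word x' (y + 1 + 1) (D # Dbar # r)"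
      using Cap.prems by (simp add: algebra_simps)
  qed (fact up)+
  ultimately show ?case using Cap.prems by (simp add: algebra_simps)
next
  case (Arch a t)
  have "center_lattice (x - 1) (y + 1)" "center_lattice (x + 1 + 2) (y + 1)"
    using Arch.prems unfolding center_lattice_def by presburger+
  moreover have up: "odd (y + 1 + 1)" "0 < y + 1 + 1" "(x + 1 + 1 - (y + 1 + 1)) mod 4 = 0"
    using Arch.prems by presburger+
  moreover have "path_word (x + 1 + 1) (y + 1 + 1) (body a @ D # Dbar # Fbar # body t @ r)"
  proof (rule Arch.IH(1))
    fix x' :: int assume x': "(x' - (y + 1 + 1)) mod 4 = 2"
    have "center_lattice (x' - 1) (y + 1 + 1 - 1)" "center_lattice (x' + 1 + 2) (y + 1)"
      "center_lattice (x' + 1 + 1 + 1) (y + 1)"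
      using x' Arch.prems unfolding center_lattice_def by presburger+
    moreover have "path_word (x' + 1 + 1 + 2) y (body t @ r)"
      using Arch.prems x' by (intro Arch.IH(2)) (simp_all, presburger)
    ultimately show "path_word x' (y + 1 + 1) (D # Dbar # Fbar # body t @ r)"
      using Arch.prems by (simp add: algebra_simps)
  qed (fact up)+
  ultimately show ?case using Arch.prems by (simp add: algebra_simps)
qed

text \<open>A body ends in \<open>F\<close> or \<open>Dbar\<close>, and neither of these opens a
  forbidden pair.\<close>

lemma smooth_body_append: "successively smooth r \<Longrightarrow> successively smooth (body t @ r)"
  by (induction t arbitrary: r) (auto simp: successively_Cons smooth_def)

text \<open>A recursive descent parser: the word is read up to the first \<open>D\<close> that
  starts at height \<open>y\<close>. At each vertex two steps are possible; they select the
  constructor of the tree, or smoothness leaves only one of them.\<close>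

lemma path_word_smooth_parse:
  assumes "path_word x y w" "successively smooth w" "odd y" "0 < y" "(x - y) mod 4 = 0"
  shows "\<exists>t r x'. w = body t @ D # r \<and> path_word x' (y - 1) r \<and> (x' - (y - 1)) mod 4 = 0"
  using assms
proof (induction w arbitrary: x y rule: length_induct)
  case (1 w)
  note IH = 1(1)[rule_format] and prems = 1(2-)
  from prems(1,3,5) show ?case
  proof (cases rule: path_word_odd_phase_0)
    \<comment> \<open>After \<open>F\<close>, the path descends at once and the tree is
      \<open>Pt\<close>, or it goes on with \<open>Fbar\<close> and the tree is a
      \<open>Flat\<close>.\<close>
    case (1 w1)
    have ph: "(x + 2 - y) mod 4 = 2" using prems(5) by presburger
    from 1(2) prems(3) ph show ?thesis
    proof (cases rule: path_word_odd_phase_2)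
      case (1 w2)
      have "(x + 2 + 1 - (y - 1)) mod 4 = 0" using ph by presburger
      moreover have "w = body Pt @ D # w2" using 1(1) \<open>w = F # w1\<close> by simp
      ultimately show ?thesis using 1(2) by (intro exI conjI)
    next
      case (2 w2)
      have ph2: "(x + 2 + 2 - y) mod 4 = 0" using ph by presburger
      have w: "w = F # Fbar # w2" using 2 \<open>w = F # w1\<close> by simp
      have sm: "successively smooth w2" using prems(2) unfolding w by (auto simp: successively_Cons)
      obtain t r x' where t: "w2 = body t @ D # r" "path_word x' (y - 1) r" "(x' - (y - 1)) mod 4 = 0"
        using IH[OF _ 2(2) sm prems(3,4) ph2] w by auto
      then have "w = body (Flat t) @ D # r" using w by simp
      then show ?thesis using t(2,3) by (intro exI conjI)
    qed
  next
    case (2 w1)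
    have e: "even (y + 1)" "y + 1 \<noteq> 0" "(x + 1 - (y + 1)) mod 4 = 0" using prems by auto
    \<comment> \<open>After \<open>Ubar\<close> smoothness rules out \<open>Dbar\<close>, so the
      climb is completed by \<open>U\<close> and the inside starts two units higher.\<close>
    from 2(2) e(2,1,3) obtain w2 where w2: "w1 = U # w2" "path_word (x + 1 + 1) (y + 1 + 1) w2"
    proof (cases rule: path_word_even_phase)
      case (2 v) then show thesis using \<open>w = Ubar # w1\<close> prems(2) by (simp add: smooth_def)
    qed
    have w: "w = Ubar # U # w2" using w2 2 by simp
    have o: "odd (y + 1 + 1)" "0 < y + 1 + 1" "(x + 1 + 1 - (y + 1 + 1)) mod 4 = 0"
      using prems by auto
    have "successively smooth w2" using w prems(2) by (auto simp: successively_Cons)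
    then have "\<exists>a r x'. w2 = body a @ D # r \<and> path_word x' (y + 1 + 1 - 1) r \<and>
      (x' - (y + 1 + 1 - 1)) mod 4 = 0"
      using IH[OF _ w2(2) _ o] w by simp
    then obtain a r x' where "w2 = body a @ D # r \<and> path_word x' (y + 1 + 1 - 1) r \<and>
      (x' - (y + 1 + 1 - 1)) mod 4 = 0" by (elim exE)
    then have a: "w2 = body a @ D # r" "path_word x' (y + 1) r" "(x' - (y + 1)) mod 4 = 0"
      by (simp_all only: add_diff_cancel_right')
    \<comment> \<open>The \<open>D\<close> that closes the inside cannot be followed by
      \<open>U\<close>, so \<open>Dbar\<close> completes the descent.\<close>
    from a(2) e(2,1) a(3) obtain r2 where r2: "r = Dbar # r2" "path_word (x' + 1) y r2"
    proof (cases rule: path_word_even_phase)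
      case (1 v)
      have "sublist [D, U] w"
        unfolding w a 1 sublist_def by (rule exI[of _ "Ubar # U # body a"], rule exI[of _ v]) simp
      then show thesis using prems(2) by (simp add: successively_smooth_iff)
    qed auto
    have ph: "(x' + 1 - y) mod 4 = 2" using a(3) by presburger
    \<comment> \<open>Back at height \<open>y\<close>, the step \<open>D\<close> ends the tree as a
      \<open>Cap\<close>, while \<open>Fbar\<close> announces a remainder and hence an
      \<open>Arch\<close>.\<close>
    from r2(2) prems(3) ph show ?thesis
    proof (cases rule: path_word_odd_phase_2)
      case (1 r3)
      have "w = body (Cap a) @ D # r3" using w a r2 1 by simp
      moreover have "(x' + 1 + 1 - (y - 1)) mod 4 = 0" using ph by presburger
      ultimately show ?thesis using 1(2) by (intro exI conjI)
    next
      case (2 r3)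
      have ph2: "(x' + 1 + 2 - y) mod 4 = 0" using ph by presburger
      have w': "w = (Ubar # U # body a @ [D, Dbar, Fbar]) @ r3" using w a r2 2 by simp
      then have len: "length r3 < length w" by simp
      have sm: "successively smooth r3"
        using prems(2) unfolding w' successively_append_iff by blast
      from IH[OF len 2(2) sm prems(3,4) ph2]
      obtain t r x' where t: "r3 = body t @ D # r" "path_word x' (y - 1) r" "(x' - (y - 1)) mod 4 = 0"
        by (elim exE conjE)
      then have "w = body (Arch a t) @ D # r" using w' by simp
      then show ?thesis using t(2,3) by (intro exI conjI)
    qed
  qed
qed

lemma path_word_smooth_words:
  "{w. path_word 0 0 w \<and> successively smooth w} = insert [] (range mot_word)"
proof (intro Set.equalityI subsetI)
  fix w assume "w \<in> {w. path_word 0 0 w \<and> successively smooth w}"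
  then have w: "path_word 0 0 w" "successively smooth w" by auto
  show "w \<in> insert [] (range mot_word)"
  proof (cases "w = []")
    case False
    then obtain s v where s: "w = s # v" "center_lattice (0 + cx s) (0 + cy s)" "0 \<le> 0 + dy s"
      "path_word (0 + dx s) (0 + dy s) v"
      using path_word_ConsE w(1) by blast
    \<comment> \<open>The other step available at the origin, \<open>Dbar\<close>, would go below
      the axis.\<close>
    have "s = U" using step_start_phase(1)[OF s(2)] s(3) by auto
    then have v: "path_word 1 1 v" "successively smooth v" using s w by (auto simp: successively_Cons)
    obtain t r x' where t: "v = body t @ D # r" "path_word x' 0 r" "x' mod 4 = 0"
      using path_word_smooth_parse[OF v] by auto
    \<comment> \<open>A step after the return to the axis would be \<open>U\<close>, directly
      preceded by \<open>D\<close>.\<close>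
    have "r = []"
    proof (rule ccontr)
      assume "r \<noteq> []"
      then obtain s' r' where s': "r = s' # r'" "center_lattice (x' + cx s') (0 + cy s')" "0 \<le> 0 + dy s'"
        using path_word_ConsE t(2) by blast
      have "s' = U" using step_start_phase(1)[OF s'(2)] s'(3) t(3) by auto
      then have "sublist [D, U] w"
        unfolding s(1) t(1) s'(1) sublist_def
        by (intro exI[of _ "s # body t"] exI[of _ r']) simp
      then show False using w(2) by (simp add: successively_smooth_iff)
    qed
    then show ?thesis using s \<open>s = U\<close> t by (auto simp: mot_word_def)
  qed simp
next
  fix w assume "w \<in> insert [] (range mot_word)"
  moreover have "path_word 0 0 (mot_word t) \<and> successively smooth (mot_word t)" for t
  proof -
    have "path_word x' 1 [D]" if "(x' - 1) mod 4 = 2" for x' :: int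
      using that by (auto simp: center_lattice_def; presburger)
    then have "path_word 1 1 (body t @ [D])" by (intro path_word_body_append) auto
    moreover have "successively smooth (body t @ [D])" by (intro smooth_body_append) simp
    ultimately show ?thesis
      by (simp add: mot_word_def center_lattice_def successively_Cons smooth_def)
  qed
  ultimately show "w \<in> {w. path_word 0 0 w \<and> successively smooth w}" by auto
qed

lemma length_filter_perching_mot_word: "length (filter perching (mot_word t)) = weight t"
proof -
  have "length (filter perching (body t)) = weight t"
    by (induction t) (auto simp: perching_def)
  then show ?thesis by (simp add: mot_word_def perching_def)
qed

subsection \<open>Arcs and circles in integer coordinates\<close>

definition pt :: "int \<Rightarrow> int \<Rightarrow> complex" where
  "pt x y = Complex (of_int x) (sqrt 3 * of_int y)"

lemma Re_pt [simp]: "Re (pt x y) = of_int x" and Im_pt [simp]: "Im (pt x y) = sqrt 3 * of_int y"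
  by (simp_all add: pt_def)

lemma pt_eq_iff [simp]: "pt x y = pt x' y' \<longleftrightarrow> x = x' \<and> y = y'"
  by (simp add: complex_eq_iff)

lemma pt_add: "pt x y + pt x' y' = pt (x + x') (y + y')"
  by (simp add: complex_eq_iff algebra_simps)

lemma pt_diff: "pt x y - pt x' y' = pt (x - x') (y - y')"
  by (simp add: complex_eq_iff algebra_simps)

lemma packing_centers_eq: "packing_centers = {pt a b | a b. center_lattice a b}"
proof (intro Set.equalityI subsetI)
  fix c assume "c \<in> packing_centers"
  then obtain i j where c: "c = pt (2 + 4 * i + 2 * j) (2 * j)"
    unfolding packing_centers_def by (auto simp: pt_def)
  have "center_lattice (2 + 4 * i + 2 * j) (2 * j)"
    unfolding center_lattice_def by presburger
  then show "c \<in> {pt a b | a b. center_lattice a b}" using c by blast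
next
  fix c assume "c \<in> {pt a b | a b. center_lattice a b}"
  then obtain a b where c: "c = pt a b" "even b" "(a - b) mod 4 = 2"
    unfolding center_lattice_def by blast
  then obtain i j where "a = 2 + 4 * i + 2 * j" "b = 2 * j"
  proof -
    have "a = 2 + 4 * ((a - b) div 4) + 2 * (b div 2)" "b = 2 * (b div 2)"
      using c(2,3) by presburger+
    then show thesis by (rule that)
  qed
  then show "c \<in> packing_centers"
    unfolding packing_centers_def c(1) by (auto simp: pt_def)
qed

lemma pt_in_packing_centers [simp]: "pt a b \<in> packing_centers \<longleftrightarrow> center_lattice a b"
  by (auto simp: packing_centers_eq)

lemma cis_multiples_of_60:
  "cis pi = -1" "cis (2 * pi / 3) = pt (-1) 1 / 2" "cis (pi / 3) = pt 1 1 / 2" "cis 0 = 1"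
  "cis (2 * pi) = 1" "cis (4 * pi / 3) = pt (-1) (-1) / 2" "cis (5 * pi / 3) = pt 1 (-1) / 2"
proof -
  \<comment> \<open>Reflection in the real axis reduces the two angles beyond \<open>pi\<close> to
    known values.\<close>
  have "4 * pi / 3 = 2 * pi - 2 * pi / 3" "5 * pi / 3 = 2 * pi - pi / 3" by (simp_all add: field_simps)
  then show "cis (4 * pi / 3) = pt (-1) (-1) / 2" "cis (5 * pi / 3) = pt 1 (-1) / 2"
    by (simp_all only: complex_eq_iff cis.sel cos_2pi_minus sin_2pi_minus)
       (simp_all add: cos_60 sin_60 cos_120 sin_120)
qed (simp_all add: complex_eq_iff cos_60 sin_60 cos_120 sin_120)

lemma pathstart_step_arc: "pathstart (step_arc (c, s)) = c - pt (cx s) (cy s)"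
proof -
  have "pathstart (step_arc (c, s)) = c + 2 * cis (start_angle s)"
    by (simp add: step_arc_def cis_conv_exp)
  then show ?thesis by (cases s) (simp_all add: cis_multiples_of_60 complex_eq_iff)
qed

lemma pathfinish_step_arc: "pathfinish (step_arc (c, s)) = c + pt (dx s - cx s) (dy s - cy s)"
proof -
  have "pathfinish (step_arc (c, s)) = c + 2 * cis (end_angle s)"
    by (simp add: step_arc_def cis_conv_exp)
  then show ?thesis by (cases s) (simp_all add: cis_multiples_of_60 complex_eq_iff)
qed

definition upper :: "step \<Rightarrow> bool" where
  "upper s \<longleftrightarrow> s \<in> {U, F, D}"

text \<open>Later arguments do not return to angles: they know an arc through its circle equation,
  its range of abscissas and the half of the circle that contains it.\<close>

lemma step_arc_coordinates:
  assumes "w \<in> path_image (step_arc (c, s))"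
  shows "(Re w - Re c) ^ 2 + (Im w - Im c) ^ 2 = 4"
    and "- of_int (cx s) \<le> Re w - Re c" and "Re w - Re c \<le> of_int (dx s - cx s)"
    and "upper s \<Longrightarrow> Im c \<le> Im w" and "\<not> upper s \<Longrightarrow> Im w \<le> Im c"
proof -
  obtain t where t: "t \<in> closed_segment (start_angle s) (end_angle s)" "w = c + 2 * cis t"
    using assms unfolding step_arc_def path_image_part_circlepath' by auto
  have w: "Re w - Re c = 2 * cos t" "Im w - Im c = 2 * sin t" using t by simp_all
  show "(Re w - Re c) ^ 2 + (Im w - Im c) ^ 2 = 4"
    unfolding w power_mult_distrib power2_eq_square[of "2 :: real"]
    using sin_cos_squared_add2[of t] by linarith
  \<comment> \<open>For the lower arcs the reflected angle \<open>u\<close> lies in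
    \<open>[0, pi]\<close>, where the cosine is monotone.\<close>
  define u where "u = 2 * pi - t"
  have cu: "cos t = cos u" "sin t = - sin u" unfolding u_def by simp_all
  have mono: "cos z \<le> cos y" if "0 \<le> y" "y \<le> z" "z \<le> pi" for y z
    using that by (intro cos_monotone_0_pi_le)
  have "- of_int (cx s) \<le> Re w - Re c \<and> Re w - Re c \<le> of_int (dx s - cx s) \<and>
    (upper s \<longrightarrow> 0 \<le> sin t) \<and> (\<not> upper s \<longrightarrow> sin t \<le> 0)"
  proof (cases s)
    case U
    then have "2 * pi / 3 \<le> t" "t \<le> pi" using t(1) by (auto simp: closed_segment_eq_real_ivl split: if_splits)
    then show ?thesis using mono[of "2 * pi / 3" t] mono[of t pi] U
      by (simp add: w cos_120 sin_ge_zero upper_def)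
  next
    case F
    then have "pi / 3 \<le> t" "t \<le> 2 * pi / 3" using t(1) by (auto simp: closed_segment_eq_real_ivl split: if_splits)
    then show ?thesis using mono[of "pi / 3" t] mono[of t "2 * pi / 3"] F
      by (simp add: w cos_120 cos_60 sin_ge_zero upper_def)
  next
    case D
    then have "0 \<le> t" "t \<le> pi / 3" using t(1) by (auto simp: closed_segment_eq_real_ivl split: if_splits)
    then show ?thesis using mono[of 0 t] mono[of t "pi / 3"] D
      by (simp add: w cos_60 sin_ge_zero upper_def)
  next
    case Ubar
    then have "0 \<le> u" "u \<le> pi / 3" using t(1) by (auto simp: u_def closed_segment_eq_real_ivl split: if_splits)
    then show ?thesis using mono[of 0 u] mono[of u "pi / 3"] Ubar
      by (simp add: w cu cos_60 sin_ge_zero upper_def)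
  next
    case Fbar
    then have "pi / 3 \<le> u" "u \<le> 2 * pi / 3" using t(1) by (auto simp: u_def closed_segment_eq_real_ivl split: if_splits)
    then show ?thesis using mono[of "pi / 3" u] mono[of u "2 * pi / 3"] Fbar
      by (simp add: w cu cos_120 cos_60 sin_ge_zero upper_def)
  next
    case Dbar
    then have "2 * pi / 3 \<le> u" "u \<le> pi" using t(1) by (auto simp: u_def closed_segment_eq_real_ivl split: if_splits)
    then show ?thesis using mono[of "2 * pi / 3" u] mono[of u pi] Dbar
      by (simp add: w cu cos_120 sin_ge_zero upper_def)
  qed
  then show "- of_int (cx s) \<le> Re w - Re c" and "Re w - Re c \<le> of_int (dx s - cx s)"
    and "upper s \<Longrightarrow> Im c \<le> Im w" and "\<not> upper s \<Longrightarrow> Im w \<le> Im c"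
    using w(2) by linarith+
qed

abbreviation arc_from :: "int \<Rightarrow> int \<Rightarrow> step \<Rightarrow> complex set" where
  "arc_from x y s \<equiv> path_image (step_arc (pt (x + cx s) (y + cy s), s))"

lemma vertices_in_arc_from:
  "pt x y \<in> arc_from x y s" "pt (x + dx s) (y + dy s) \<in> arc_from x y s"
  using pathstart_in_path_image[of "step_arc (pt (x + cx s) (y + cy s), s)"]
    pathfinish_in_path_image[of "step_arc (pt (x + cx s) (y + cy s), s)"]
  by (simp_all add: pathstart_step_arc pathfinish_step_arc pt_add pt_diff)

lemma arc_from_on_circle:
  assumes "w \<in> arc_from x y s"
  shows "(Re w - of_int (x + cx s)) ^ 2 + (Im w - sqrt 3 * of_int (y + cy s)) ^ 2 = 4"
  using step_arc_coordinates(1)[OF assms] by simp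

lemma arc_from_abscissa:
  assumes "w \<in> arc_from x y s"
  shows "of_int x \<le> Re w" "Re w \<le> of_int (x + dx s)"
  using step_arc_coordinates(2,3)[OF assms] by simp_all

text \<open>Only \<open>Fbar\<close> dips below both its endpoints, by \<open>2 - sqrt 3\<close> in
  true ordinate. The cruder bound of one unit of \<open>sqrt 3\<close> keeps the value
  integral.\<close>

definition low :: "int \<Rightarrow> step \<Rightarrow> int" where
  "low y s = (if s = Fbar then y - 1 else min y (y + dy s))"

lemma arc_from_low:
  assumes "w \<in> arc_from x y s"
  shows "sqrt 3 * of_int (low y s) \<le> Im w"
proof -
  define p q where "p = Re w - of_int (x + cx s)" and "q = Im w - sqrt 3 * of_int (y + cy s)"
  note c = step_arc_coordinates[OF assms, unfolded Re_pt Im_pt, folded p_def q_def]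
  have Im: "Im w = q + sqrt 3 * of_int (y + cy s)" by (simp add: q_def)
  \<comment> \<open>On a circle of radius 2, the offset \<open>1\<close> in abscissa corresponds to
    the offset \<open>sqrt 3\<close> in ordinate.\<close>
  have q: "\<bar>q\<bar> \<le> sqrt 3" if "1 \<le> \<bar>p\<bar>"
  proof -
    have "1 \<le> p ^ 2" using that by (simp add: abs_le_square_iff[of 1, simplified])
    then have "q ^ 2 \<le> 3" using c(1) by linarith
    then show ?thesis by (metis real_sqrt_abs real_sqrt_le_iff)
  qed
  have q': "sqrt 3 \<le> \<bar>q\<bar>" if "\<bar>p\<bar> \<le> 1"
  proof -
    have "p ^ 2 \<le> 1" using that by (simp add: abs_square_le_1)
    then have "3 \<le> q ^ 2" using c(1) by linarith
    then show ?thesis by (metis real_sqrt_abs real_sqrt_le_iff)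
  qed
  have "q ^ 2 \<le> 4" using c(1) zero_le_power2[of p] by linarith
  then have q2: "\<bar>q\<bar> \<le> 2" using abs_le_square_iff[of q 2] by simp
  have s: "upper s \<Longrightarrow> 0 \<le> q" "\<not> upper s \<Longrightarrow> q \<le> 0" using c(4,5) by (auto simp: q_def)
  define r where "r = sqrt 3"
  have r: "1 < r" "r < 2" by (simp_all add: r_def real_less_lsqrt)
  show ?thesis
    using c(2,3) q q' q2 s r unfolding Im low_def r_def[symmetric]
    by (cases s) (auto simp: upper_def algebra_simps)
qed

text \<open>At an extreme abscissa the circle equation leaves at most two ordinates, and the half of
  the circle containing the arc decides between them.\<close>

lemma arc_from_at_vertices:
  assumes "w \<in> arc_from x y s"
  shows "Re w = of_int x \<Longrightarrow> w = pt x y"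
    and "Re w = of_int (x + dx s) \<Longrightarrow> w = pt (x + dx s) (y + dy s)"
proof -
  define q where "q = Im w - sqrt 3 * of_int (y + cy s)"
  have Im: "Im w = q + sqrt 3 * of_int (y + cy s)" by (simp add: q_def)
  note c = step_arc_coordinates[OF assms, unfolded Re_pt Im_pt, folded q_def]
  have s: "upper s \<Longrightarrow> 0 \<le> q" "\<not> upper s \<Longrightarrow> q \<le> 0" using c(4,5) by (auto simp: q_def)
  have q: "q ^ 2 = 3 \<Longrightarrow> 0 \<le> q \<Longrightarrow> q = sqrt 3" "q ^ 2 = 3 \<Longrightarrow> q \<le> 0 \<Longrightarrow> q = - sqrt 3"
    by (metis real_sqrt_abs abs_of_nonneg, metis real_sqrt_abs abs_of_nonpos minus_minus)
  show "w = pt x y" if "Re w = of_int x"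
    using c(1) s q that by (cases s) (auto simp: complex_eq_iff Im upper_def algebra_simps)
  show "w = pt (x + dx s) (y + dy s)" if "Re w = of_int (x + dx s)"
    using c(1) s q that by (cases s) (auto simp: complex_eq_iff Im upper_def algebra_simps)
qed

section \<open>Distances between circles of the packing\<close>

lemma center_lattice_diff:
  assumes "center_lattice a b" "center_lattice a' b'"
  shows "even (b - b')" "4 dvd (a - a') - (b - b')"
proof -
  have "4 dvd (a - b) - (a' - b')"
    using assms by (simp only: center_lattice_def mod_eq_dvd_iff[symmetric])
  then show "4 dvd (a - a') - (b - b')" by (simp add: algebra_simps)
qed (use assms in \<open>simp add: center_lattice_def\<close>)

text \<open>The form \<open>m ^ 2 + 3 * n ^ 2\<close> is the squared true distance, so distinct
  centres are at least 4 apart. The congruences leave only differences that are large in one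
  coordinate or at least 2 in both.\<close>

lemma center_lattice_separation:
  assumes "center_lattice a b" "center_lattice a' b'" "(a, b) \<noteq> (a', b')"
  shows "16 \<le> (a - a') ^ 2 + 3 * (b - b') ^ 2"
proof -
  define m n where "m = a - a'" and "n = b - b'"
  have "even n" "4 dvd m - n" "m \<noteq> 0 \<or> n \<noteq> 0"
    using center_lattice_diff[OF assms(1,2)] assms(3) by (auto simp: m_def n_def)
  moreover from this have "2 dvd m" by presburger
  moreover have "n = 0 \<Longrightarrow> 4 dvd m" "m = 0 \<Longrightarrow> 4 dvd n" using \<open>4 dvd m - n\<close> by auto
  ultimately have "4 \<le> \<bar>n\<bar> \<or> (2 \<le> \<bar>n\<bar> \<and> 2 \<le> \<bar>m\<bar>) \<or> 4 \<le> \<bar>m\<bar>"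
    using dvd_imp_le_int[of n 2] dvd_imp_le_int[of m 2] dvd_imp_le_int[of m 4] dvd_imp_le_int[of n 4]
    by (cases "m = 0"; cases "n = 0") simp_all
  moreover have "k ^ 2 \<le> j ^ 2" if "k \<le> \<bar>j\<bar>" "0 \<le> k" for k j :: int
    using that by (metis abs_le_square_iff abs_of_nonneg)
  from this[of 4 n] this[of 2 n] this[of 2 m] this[of 4 m]
  have "4 \<le> \<bar>n\<bar> \<Longrightarrow> 16 \<le> n ^ 2" "2 \<le> \<bar>n\<bar> \<Longrightarrow> 4 \<le> n ^ 2" "2 \<le> \<bar>m\<bar> \<Longrightarrow> 4 \<le> m ^ 2" "4 \<le> \<bar>m\<bar> \<Longrightarrow> 16 \<le> m ^ 2"
    by simp_all
  ultimately have "16 \<le> m ^ 2 + 3 * n ^ 2"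
    using zero_le_power2[of m] zero_le_power2[of n] by linarith
  then show ?thesis by (simp add: m_def n_def)
qed

text \<open>By the triangle inequality, a point at distance 2 from one centre is at distance at
  least 2 from every other one.\<close>

lemma arc_from_outside:
  assumes "w \<in> arc_from x y s" "center_lattice (x + cx s) (y + cy s)" "center_lattice a b"
  shows "4 \<le> (Re w - of_int a) ^ 2 + (Im w - sqrt 3 * of_int b) ^ 2"
proof -
  let ?c' = "pt (x + cx s) (y + cy s)" and ?c = "pt a b"
  have norm: "norm z = sqrt (Re z ^ 2 + Im z ^ 2)" for z by (simp add: cmod_def)
  have w: "norm (w - ?c') = 2"
    using arc_from_on_circle[OF assms(1)] by (simp add: norm)
  have "2 \<le> norm (w - ?c)"
  proof (cases "(a, b) = (x + cx s, y + cy s)")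
    case True
    then show ?thesis using w by simp
  next
    case False
    then have "16 \<le> (a - (x + cx s)) ^ 2 + 3 * (b - (y + cy s)) ^ 2"
      using center_lattice_separation assms by blast
    then have "real_of_int 16 \<le> of_int ((a - (x + cx s)) ^ 2 + 3 * (b - (y + cy s)) ^ 2)"
      by (simp only: of_int_le_iff)
    then have "4 ^ 2 \<le> Re (?c - ?c') ^ 2 + Im (?c - ?c') ^ 2"
      by (simp add: power_mult_distrib flip: right_diff_distrib)
    then have "4 \<le> norm (?c - ?c')"
      unfolding norm by (rule real_le_rsqrt)
    moreover have "norm (?c - ?c') \<le> norm (w - ?c') + norm (w - ?c)"
      using norm_triangle_ineq4[of "w - ?c'" "w - ?c"] by simp
    ultimately show ?thesis using w by simp
  qed
  then have "2 ^ 2 \<le> norm (w - ?c) ^ 2" by (intro power_mono) auto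
  then show ?thesis by (simp add: cmod_power2)
qed

text \<open>With \<open>p\<close> and \<open>q\<close> the coordinates of \<open>w\<close> relative to one centre and \<open>d\<close> the vector to the other, the
  two circle equations give \<open>|2 (p, q) - d|^2 = 16 - |d|^2 \<le> 0\<close>, so \<open>w\<close> is the midpoint.\<close>

lemma arc_from_touches_at_vertex:
  assumes "w \<in> arc_from x y s" "center_lattice (x + cx s) (y + cy s)" "center_lattice a b"
    and "w \<in> sphere (pt a b) 2" "(a, b) \<noteq> (x + cx s, y + cy s)"
  shows "w = pt x y \<or> w = pt (x + dx s) (y + dy s)"
proof -
  define m n where "m = a - (x + cx s)" and "n = b - (y + cy s)"
  define p q where "p = Re w - of_int (x + cx s)" and "q = Im w - sqrt 3 * of_int (y + cy s)"
  have pq: "p ^ 2 + q ^ 2 = 4"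
    using arc_from_on_circle[OF assms(1)] by (simp add: p_def q_def)
  have "dist (pt a b) w ^ 2 = 4" using assms(4) by simp
  then have "(p - of_int m) ^ 2 + (q - sqrt 3 * of_int n) ^ 2 = 4"
    by (simp add: dist_norm norm_minus_commute cmod_power2 p_def q_def m_def n_def algebra_simps)
  then have "(p - of_int m) ^ 2 + (q ^ 2 - 2 * sqrt 3 * q * of_int n + 3 * (of_int n) ^ 2) = 4"
    by (simp add: power2_diff power_mult_distrib algebra_simps)
  moreover have "(2 * q - sqrt 3 * of_int n) ^ 2 = 4 * q ^ 2 - 4 * sqrt 3 * q * of_int n + 3 * (of_int n) ^ 2"
    by (simp add: power2_diff power_mult_distrib algebra_simps)
  ultimately have eq: "(2 * p - of_int m) ^ 2 + (2 * q - sqrt 3 * of_int n) ^ 2 =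
      16 - of_int (m ^ 2 + 3 * n ^ 2)"
    using pq by (simp add: power2_eq_square algebra_simps)
  have sep: "16 \<le> m ^ 2 + 3 * n ^ 2"
    unfolding m_def n_def using center_lattice_separation assms by blast
  then have "(16::real) - of_int (m ^ 2 + 3 * n ^ 2) \<le> 0" by linarith
  then have "(2 * p - of_int m) ^ 2 + (2 * q - sqrt 3 * of_int n) ^ 2 \<le> 0" using eq by linarith
  then have p: "2 * p = of_int m" "2 * q = sqrt 3 * of_int n"
    by (simp_all only: sum_power2_le_zero_iff) simp_all
  have "real_of_int (m ^ 2 + 3 * n ^ 2) = of_int 16" using eq p by simp
  then have mn: "m ^ 2 + 3 * n ^ 2 = 16" by (simp only: of_int_eq_iff)
  note p(1)
  moreover have "even m" "m \<noteq> 0"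
  proof -
    have "even n" "4 dvd m - n"
      using center_lattice_diff[OF assms(3,2)] by (simp_all add: m_def n_def)
    then show "even m" by presburger
    show "m \<noteq> 0"
    proof
      assume "m = 0"
      then have "3 * n ^ 2 = 16" using mn by simp
      then show False by presburger
    qed
  qed
  ultimately obtain k where k: "p = of_int k" "k \<noteq> 0" by (auto elim!: evenE)
  have "- of_int (cx s) \<le> p" "p \<le> of_int (dx s - cx s)"
    using arc_from_abscissa[OF assms(1)] by (auto simp: p_def)
  then have "- cx s \<le> k" "k \<le> dx s - cx s" unfolding k by linarith+
  \<comment> \<open>An integer strictly between the bounds occurs only for \<open>F\<close> and
    \<open>Fbar\<close>, and it is 0, which is excluded.\<close>
  then have "k = - cx s \<or> k = dx s - cx s" using k(2) by (cases s) auto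
  moreover have "Re w = of_int (x + cx s) + of_int k" using k(1) by (simp add: p_def)
  ultimately have "Re w = of_int x \<or> Re w = of_int (x + dx s)" by auto
  then show ?thesis using arc_from_at_vertices[OF assms(1)] by blast
qed

subsection \<open>Paths as words\<close>

definition vx :: "step list \<Rightarrow> nat \<Rightarrow> int" where "vx w i = (\<Sum>k<i. dx (w ! k))"
definition vy :: "step list \<Rightarrow> nat \<Rightarrow> int" where "vy w i = (\<Sum>k<i. dy (w ! k))"

lemma vx_simps [simp]: "vx w 0 = 0" "vx w (Suc i) = vx w i + dx (w ! i)"
  and vy_simps [simp]: "vy w 0 = 0" "vy w (Suc i) = vy w i + dy (w ! i)"
  by (simp_all add: vx_def vy_def)

lemma vx_Cons: "vx (s # w) (Suc i) = dx s + vx w i"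
  and vy_Cons: "vy (s # w) (Suc i) = dy s + vy w i"
  by (simp_all add: vx_def vy_def sum.lessThan_Suc_shift del: sum.lessThan_Suc)

lemma dx_bounds: "1 \<le> dx s" and dy_bounds: "- 1 \<le> dy s" "dy s \<le> 1"
  by (cases s; simp)+

lemma vx_less: "i < j \<Longrightarrow> vx w i + dx (w ! i) \<le> vx w j"
proof (induction j)
  case (Suc j)
  then show ?case using dx_bounds[of "w ! j"] by (cases "i = j") auto
qed simp

lemma vx_mono: "i \<le> j \<Longrightarrow> vx w i \<le> vx w j"
  using vx_less[of i j w] dx_bounds[of "w ! i"] by (cases "i = j") auto

text \<open>The recursive form serves the parser; this indexed form serves the geometry.\<close>

lemma path_word_iff:
  "path_word x y w \<longleftrightarrow>
    (\<forall>i<length w. center_lattice (x + vx w i + cx (w ! i)) (y + vy w i + cy (w ! i)) \<and> 0 \<le> y + vy w (Suc i)) \<and>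
    y + vy w (length w) = 0"
proof (induction w arbitrary: x y)
  case (Cons s w)
  show ?case
    unfolding path_word.simps Cons.IH length_Cons All_less_Suc2 vx_Cons vy_Cons
    by (auto simp: add.assoc simp del: vx_simps(2) vy_simps(2))
qed simp

definition located :: "step list \<Rightarrow> (complex \<times> step) list" where
  "located w = map (\<lambda>i. (pt (vx w i + cx (w ! i)) (vy w i + cy (w ! i)), w ! i)) [0..<length w]"

lemma map_snd_located [simp]: "map snd (located w) = w"
  by (simp add: located_def comp_def map_nth)

lemma trace_located:
  "trace (located w) = insert 0 (\<Union>i<length w. arc_from (vx w i) (vy w i) (w ! i))"
  by (auto simp: trace_def located_def)

lemma endpoint_located: "endpoint (located w) = pt (vx w (length w)) (vy w (length w))"
proof (cases "length w")
  case 0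
  then show ?thesis by (simp add: endpoint_def located_def complex_eq_iff)
next
  case (Suc n)
  then show ?thesis
    by (simp add: endpoint_def located_def pathfinish_step_arc pt_add)
qed

lemma vertex_in_trace:
  assumes "i \<le> length w"
  shows "pt (vx w i) (vy w i) \<in> trace (located w)"
proof (cases i)
  case 0
  then show ?thesis by (simp add: trace_def complex_eq_iff)
next
  case (Suc k)
  then show ?thesis
    using vertices_in_arc_from(2)[where x = "vx w k" and y = "vy w k" and s = "w ! k"] assms by (auto simp: trace_located)
qed

text \<open>The types of the arcs determine the circles: the first arc starts at the origin, and
  each centre follows from the point where the previous arc ends.\<close>

lemma path_in_packing_located:
  assumes "path_in_packing P"
  shows "P = located (map snd P)"
proof -
  let ?w = "map snd P"
  have start: "P \<noteq> [] \<Longrightarrow> pathstart (step_arc (hd P)) = 0"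
    and succ: "\<And>i. Suc i < length P \<Longrightarrow>
      pathfinish (step_arc (P ! i)) = pathstart (step_arc (P ! Suc i))"
    using assms by (auto simp: path_in_packing_def successively_conv_nth)
  have "fst (P ! i) = pt (vx ?w i + cx (?w ! i)) (vy ?w i + cy (?w ! i))" if "i < length P" for i
    using that
  proof (induction i)
    case 0
    then show ?case
      using start pathstart_step_arc[of "fst (P ! 0)" "snd (P ! 0)"] by (simp add: hd_conv_nth)
  next
    case (Suc i)
    have "fst (P ! Suc i) = fst (P ! i) + pt (dx (?w ! i) - cx (?w ! i)) (dy (?w ! i) - cy (?w ! i)) +
      pt (cx (?w ! Suc i)) (cy (?w ! Suc i))"
      using succ[OF Suc.prems] Suc.prems pathstart_step_arc[of "fst (P ! Suc i)" "snd (P ! Suc i)"]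
        pathfinish_step_arc[of "fst (P ! i)" "snd (P ! i)"] by (simp add: diff_eq_eq)
    then show ?case using Suc by (simp add: pt_add)
  qed
  then show ?thesis
    by (intro nth_equalityI) (auto simp: located_def prod_eq_iff)
qed

lemma packing_path_located_iff: "packing_path (located w) \<longleftrightarrow> path_word 0 0 w"
proof
  assume P: "packing_path (located w)"
  show "path_word 0 0 w"
    unfolding path_word_iff
  proof (intro conjI allI impI)
    fix i assume i: "i < length w"
    then have "(pt (vx w i + cx (w ! i)) (vy w i + cy (w ! i)), w ! i) \<in> set (located w)"
      by (auto simp: located_def)
    then show "center_lattice (0 + vx w i + cx (w ! i)) (0 + vy w i + cy (w ! i))"
      using P by (auto simp: packing_path_def path_in_packing_def)
    have "pt (vx w (Suc i)) (vy w (Suc i)) \<in> trace (located w)"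
      using i by (intro vertex_in_trace) simp
    then have "0 \<le> Im (pt (vx w (Suc i)) (vy w (Suc i)))"
      using P unfolding packing_path_def path_in_packing_def by blast
    then show "0 \<le> 0 + vy w (Suc i)" by (simp add: zero_le_mult_iff)
  next
    show "0 + vy w (length w) = 0"
      using P by (simp add: packing_path_def endpoint_located)
  qed
next
  assume w: "path_word 0 0 w"
  then have lat: "\<And>i. i < length w \<Longrightarrow> center_lattice (vx w i + cx (w ! i)) (vy w i + cy (w ! i))"
    and nonneg: "\<And>i. i < length w \<Longrightarrow> 0 \<le> vy w (Suc i)" and "vy w (length w) = 0"
    unfolding path_word_iff by simp_all
  have nonneg': "0 \<le> vy w i" if "i < length w" for i
    using that nonneg[of "i - 1"] by (cases i) auto
  have "0 \<le> Re z \<and> 0 \<le> Im z" if z: "z \<in> arc_from (vx w i) (vy w i) (w ! i)" and i: "i < length w" for z i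
  proof
    have "0 \<le> vx w i" using vx_mono[of 0 i w] by simp
    then show "0 \<le> Re z" using arc_from_abscissa(1)[OF z] by linarith
    \<comment> \<open>The one arc that dips starts at odd height, because its centre has even
      height; hence it has a full unit to spare.\<close>
    have "w ! i = Fbar \<Longrightarrow> odd (vy w i)" using lat[OF i] by (auto simp: center_lattice_def)
    then have "w ! i = Fbar \<Longrightarrow> 1 \<le> vy w i" using nonneg'[OF i] by presburger
    then have "0 \<le> low (vy w i) (w ! i)"
      using nonneg[OF i] nonneg'[OF i] by (auto simp: low_def)
    then show "0 \<le> Im z"
      using arc_from_low[OF z] by (smt (verit) mult_nonneg_nonneg of_int_0_le_iff real_sqrt_ge_zero)
  qed
  then have "trace (located w) \<subseteq> {z. 0 \<le> Re z \<and> 0 \<le> Im z}"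
    by (auto simp: trace_located)
  moreover have "successively (\<lambda>a b. pathfinish (step_arc a) = pathstart (step_arc b)) (located w)"
    by (auto simp: successively_conv_nth located_def pathfinish_step_arc pathstart_step_arc pt_add pt_diff)
  moreover have "pathstart (step_arc (hd (located w))) = 0" if "located w \<noteq> []"
    using that by (auto simp: located_def hd_map pathstart_step_arc pt_diff complex_eq_iff)
  moreover have "\<forall>a\<in>set (located w). fst a \<in> packing_centers"
    using lat by (auto simp: located_def)
  ultimately show "packing_path (located w)"
    using \<open>vy w (length w) = 0\<close>
    by (simp add: packing_path_def path_in_packing_def endpoint_located)
qed

lemma inchworm_paths_eq:
  "{P. inchworm_path P} = located ` {w. path_word 0 0 w \<and> successively smooth w}"
proof (intro Set.equalityI subsetI)
  fix P assume "P \<in> {P. inchworm_path P}"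
  then have P: "inchworm_path P" by simp
  then have "P = located (map snd P)"
    by (intro path_in_packing_located) (simp add: inchworm_path_def packing_path_def)
  moreover from this have "path_word 0 0 (map snd P)"
    using P packing_path_located_iff by (metis inchworm_path_def)
  ultimately show "P \<in> located ` {w. path_word 0 0 w \<and> successively smooth w}"
    using P by (auto simp: inchworm_path_def successively_smooth_iff)
next
  fix P assume "P \<in> located ` {w. path_word 0 0 w \<and> successively smooth w}"
  then show "P \<in> {P. inchworm_path P}"
    by (auto simp: inchworm_path_def packing_path_located_iff successively_smooth_iff)
qed

subsection \<open>The kissing number\<close>

text \<open>No point of the path lies inside the circle, so a point of the path above the centre line is
  already above the whole circle.\<close>

lemma circle_belowI:
  assumes "center_lattice a b" "path_word 0 0 w" "0 \<le> b" "0 \<le> a" "a \<le> vx w (length w)"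
    and above: "\<And>u. u \<in> trace (located w) \<Longrightarrow> \<bar>Re u - of_int a\<bar> \<le> 2 \<Longrightarrow> sqrt 3 * of_int b \<le> Im u"
    and "w \<noteq> []"
  shows "circle_below (pt a b) (located w)"
  unfolding circle_below_def
proof (intro conjI ballI impI)
  fix z u assume z: "z \<in> sphere (pt a b) 2" and u: "u \<in> trace (located w)" and Re: "Re z = Re u"
  have "u \<in> (\<Union>i<length w. arc_from (vx w i) (vy w i) (w ! i))"
  proof (cases "u = 0")
    case True
    then have "u = pt (vx w 0) (vy w 0)" by (simp add: complex_eq_iff)
    then show ?thesis using \<open>w \<noteq> []\<close> vertices_in_arc_from(1) by blast
  qed (use u in \<open>auto simp: trace_located\<close>)
  then obtain i where i: "i < length w" "u \<in> arc_from (vx w i) (vy w i) (w ! i)" by blast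
  have "4 \<le> (Re u - of_int a) ^ 2 + (Im u - sqrt 3 * of_int b) ^ 2"
    using arc_from_outside[OF i(2) _ assms(1)] assms(2) i(1) by (simp add: path_word_iff)
  moreover have "dist (pt a b) z ^ 2 = 4" using z by simp
  then have z4: "(Re u - of_int a) ^ 2 + (Im z - sqrt 3 * of_int b) ^ 2 = 4"
    by (simp add: dist_norm norm_minus_commute cmod_power2 Re)
  ultimately have "(Im z - sqrt 3 * of_int b) ^ 2 \<le> (Im u - sqrt 3 * of_int b) ^ 2" by linarith
  then have "\<bar>Im z - sqrt 3 * of_int b\<bar> \<le> \<bar>Im u - sqrt 3 * of_int b\<bar>"
    by (simp only: abs_le_square_iff)
  moreover have "(Re u - of_int a) ^ 2 \<le> 4"
    using z4 zero_le_power2[of "Im z - sqrt 3 * of_int b"] by linarith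
  then have "\<bar>Re u - of_int a\<bar> \<le> 2" using abs_le_square_iff[of "Re u - of_int a" 2] by simp
  then have "sqrt 3 * of_int b \<le> Im u" using above u by blast
  ultimately show "Im z \<le> Im u" by linarith
qed (use assms in \<open>simp_all add: endpoint_located\<close>)

text \<open>Two invariants of the vertices \<open>(x, y)\<close> of a path: the first propagates from a vertex near
  the top of the circle with centre \<open>(a, b)\<close> to all later vertices, the second to all earlier ones.\<close>

definition clear_right :: "int \<Rightarrow> int \<Rightarrow> int \<Rightarrow> int \<Rightarrow> bool" where
  "clear_right a b x y \<longleftrightarrow> a - 1 \<le> x \<and> (x \<le> a + 1 \<longrightarrow> b + 1 \<le> y) \<and> (x = a + 2 \<longrightarrow> b \<le> y)"

definition clear_left :: "int \<Rightarrow> int \<Rightarrow> int \<Rightarrow> int \<Rightarrow> bool" where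
  "clear_left a b x y \<longleftrightarrow> x \<le> a + 1 \<and> (a - 1 \<le> x \<longrightarrow> b + 1 \<le> y) \<and> (x = a - 2 \<longrightarrow> b \<le> y)"

text \<open>Only a descent from height \<open>b + 1\<close> at abscissa \<open>a - 1\<close> or
  \<open>a\<close> could break the invariant, and the congruences for the two centres forbid
  it.\<close>

lemma clear_right_step:
  assumes "center_lattice a b" "center_lattice (x + cx s) (y + cy s)" "clear_right a b x y"
  shows "clear_right a b (x + dx s) (y + dy s)"
proof -
  have "\<not> (y = b + 1 \<and> (x = a - 1 \<or> x = a) \<and> s \<in> {D, Dbar})"
  proof
    assume *: "y = b + 1 \<and> (x = a - 1 \<or> x = a) \<and> s \<in> {D, Dbar}"
    have "even b" "4 dvd a - b - 2"
      using assms(1) by (simp_all add: center_lattice_iff_dvd)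
    moreover have "even (y + cy s)" "4 dvd (x + cx s) - (y + cy s) - 2"
      using assms(2) by (simp_all add: center_lattice_iff_dvd)
    ultimately show False using * by (auto; presburger)
  qed
  then show ?thesis
    using assms(3) unfolding clear_right_def by (cases s) auto
qed

lemma clear_left_step:
  assumes "center_lattice a b" "center_lattice (x + cx s) (y + cy s)" "clear_left a b (x + dx s) (y + dy s)"
  shows "clear_left a b x y"
proof -
  have "\<not> (y = b \<and> (x = a - 1 \<or> x = a) \<and> s \<in> {U, Ubar})"
  proof
    assume *: "y = b \<and> (x = a - 1 \<or> x = a) \<and> s \<in> {U, Ubar}"
    have "even b" "4 dvd a - b - 2"
      using assms(1) by (simp_all add: center_lattice_iff_dvd)
    moreover have "even (y + cy s)" "4 dvd (x + cx s) - (y + cy s) - 2"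
      using assms(2) by (simp_all add: center_lattice_iff_dvd)
    ultimately show False using * by (auto; presburger)
  qed
  then show ?thesis
    using assms(3) unfolding clear_left_def by (cases s) auto
qed

lemma low_ge: "y - 1 \<le> low y s" "y + dy s - 1 \<le> low y s"
  using dy_bounds[of s] by (auto simp: low_def)

lemma sqrt3_mult_mono: "m \<le> n \<Longrightarrow> sqrt 3 * of_int m \<le> sqrt 3 * of_int n"
  by simp

text \<open>Up to abscissa \<open>a + 1\<close> the invariant keeps one unit in reserve, the most
  that \<open>low\<close> loses from the starting height. An arc starting at abscissa
  \<open>a + 2\<close> contributes only its first vertex.\<close>

lemma clear_right_arc:
  assumes "clear_right a b x y" "u \<in> arc_from x y s" "Re u \<le> of_int a + 2"
  shows "sqrt 3 * of_int b \<le> Im u"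
proof -
  have "x \<le> a + 2" using arc_from_abscissa(1)[OF assms(2)] assms(3) by linarith
  then consider "x \<le> a + 1" | "x = a + 2" by linarith
  then show ?thesis
  proof cases
    case 1
    then have "b \<le> low y s" using assms(1) low_ge(1)[of y s] by (auto simp: clear_right_def)
    then show ?thesis using arc_from_low[OF assms(2)] sqrt3_mult_mono by (meson order_trans)
  next
    case 2
    then have "u = pt x y"
      using arc_from_abscissa(1)[OF assms(2)] assms(3) by (intro arc_from_at_vertices(1)[OF assms(2)]) simp
    then show ?thesis using 2 assms(1) by (simp add: clear_right_def)
  qed
qed

lemma clear_left_arc:
  assumes "clear_left a b (x + dx s) (y + dy s)" "u \<in> arc_from x y s" "of_int a - 2 \<le> Re u"
  shows "sqrt 3 * of_int b \<le> Im u"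
proof -
  have "a - 2 \<le> x + dx s" using arc_from_abscissa(2)[OF assms(2)] assms(3) by linarith
  then consider "a - 1 \<le> x + dx s" | "x + dx s = a - 2" by linarith
  then show ?thesis
  proof cases
    case 1
    then have "b \<le> low y s" using assms(1) low_ge(2)[of y s] by (auto simp: clear_left_def)
    then show ?thesis using arc_from_low[OF assms(2)] sqrt3_mult_mono by (meson order_trans)
  next
    case 2
    then have "u = pt (x + dx s) (y + dy s)"
      using arc_from_abscissa(2)[OF assms(2)] assms(3)
      by (intro arc_from_at_vertices(2)[OF assms(2)]) linarith
    then show ?thesis using 2 assms(1) by (simp add: clear_left_def)
  qed
qed

text \<open>The vertex is the tangency point at 120 or 60 degrees of the circle. Both invariants
  hold there and spread along the path, one in each direction.\<close>

lemma circle_below_near_vertex: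
  assumes w: "path_word 0 0 w" and ab: "center_lattice a b" and range: "0 \<le> a" "a \<le> vx w (length w)"
    and j: "j \<le> length w" "vx w j = a - 1 \<or> vx w j = a + 1" "vy w j = b + 1"
  shows "circle_below (pt a b) (located w)"
proof -
  have lat: "\<And>i. i < length w \<Longrightarrow> center_lattice (vx w i + cx (w ! i)) (vy w i + cy (w ! i))"
    and nonneg: "\<And>i. i < length w \<Longrightarrow> 0 \<le> vy w (Suc i)"
    using w unfolding path_word_iff by simp_all
  have "0 \<le> vy w j" using nonneg[of "j - 1"] j(1) by (cases j) auto
  \<comment> \<open>The height of the vertex gives only \<open>b \<ge> -1\<close>; the parity of
    \<open>b\<close> does the rest.\<close>
  then have "0 \<le> b" using j(3) ab unfolding center_lattice_def by presburger
  have right: "clear_right a b (vx w k) (vy w k)" if "j \<le> k" "k \<le> length w" for k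
    using that
  proof (induction k rule: dec_induct)
    case base
    then show ?case using j by (auto simp: clear_right_def)
  next
    case (step k)
    then show ?case using clear_right_step[OF ab lat[of k]] by simp
  qed
  have left: "clear_left a b (vx w k) (vy w k)" if "k \<le> j" for k
    using that
  proof (induction k rule: inc_induct)
    case base
    then show ?case using j by (auto simp: clear_left_def)
  next
    case (step k)
    then show ?case using clear_left_step[OF ab lat[of k]] j(1) by simp
  qed
  show ?thesis
  proof (rule circle_belowI[OF ab w \<open>0 \<le> b\<close> range])
    show "w \<noteq> []" using j \<open>0 \<le> b\<close> by auto
    fix u assume u: "u \<in> trace (located w)" and Re: "\<bar>Re u - of_int a\<bar> \<le> 2"
    have arcs: "sqrt 3 * of_int b \<le> Im u" if "u \<in> arc_from (vx w k) (vy w k) (w ! k)" "k < length w" for k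
    proof (cases "j \<le> k")
      case True
      then show ?thesis using clear_right_arc[OF right that(1)] that(2) Re by linarith
    next
      case False
      then have "clear_left a b (vx w (Suc k)) (vy w (Suc k))" by (intro left) simp
      then show ?thesis using clear_left_arc[OF _ that(1), of a b] Re by auto
    qed
    show "sqrt 3 * of_int b \<le> Im u"
    proof (cases "u = 0")
      case True
      then have "u = pt (vx w 0) (vy w 0)" by (simp add: complex_eq_iff)
      then show ?thesis using \<open>w \<noteq> []\<close> arcs[of 0] vertices_in_arc_from(1) by blast
    qed (use u arcs in \<open>auto simp: trace_located\<close>)
  qed
qed

section \<open>Contacts of a path with the circles below it\<close>

lemma circle_below_vertex_height:
  assumes "circle_below (pt a b) (located w)" "j \<le> length w"
  shows "\<bar>vx w j - a\<bar> \<le> 2 \<Longrightarrow> b \<le> vy w j"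
    and "\<bar>vx w j - a\<bar> \<le> 1 \<Longrightarrow> b + 1 \<le> vy w j"
proof -
  define m where "m = vx w j - a"
  define h where "h = sqrt (4 - (of_int m) ^ 2)"
  have up: "sqrt 3 * of_int b + h \<le> sqrt 3 * of_int (vy w j)" if "\<bar>m\<bar> \<le> 2"
  proof -
    have "\<bar>real_of_int m\<bar> \<le> \<bar>2\<bar>" using that by linarith
    then have "(real_of_int m) ^ 2 \<le> 2 ^ 2" by (simp only: abs_le_square_iff)
    then have h2: "h ^ 2 = 4 - (of_int m) ^ 2" by (simp add: h_def)
    \<comment> \<open>This is the upper point of the circle with the abscissa of the vertex.\<close>
    let ?z = "Complex (of_int (vx w j)) (sqrt 3 * of_int b + h)"
    have "norm (pt a b - ?z) = sqrt ((of_int m) ^ 2 + h ^ 2)"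
      by (simp add: cmod_def m_def power2_commute)
    then have "?z \<in> sphere (pt a b) 2" by (simp add: h2 dist_norm)
    moreover have "Re ?z = Re (pt (vx w j) (vy w j))" by simp
    ultimately have "Im ?z \<le> Im (pt (vx w j) (vy w j))"
      using assms(1) vertex_in_trace[OF assms(2)] unfolding circle_below_def by blast
    then show ?thesis by simp
  qed
  show "b \<le> vy w j" if "\<bar>vx w j - a\<bar> \<le> 2"
  proof -
    have "\<bar>real_of_int m\<bar> \<le> \<bar>2\<bar>" using that unfolding m_def by linarith
    then have "(real_of_int m) ^ 2 \<le> 2 ^ 2" by (simp only: abs_le_square_iff)
    then have "0 \<le> h" by (simp add: h_def)
    moreover have "\<bar>m\<bar> \<le> 2" using that by (simp add: m_def)
    ultimately have "sqrt 3 * of_int b \<le> sqrt 3 * of_int (vy w j)" using up by linarith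
    then show ?thesis by simp
  qed
  show "b + 1 \<le> vy w j" if "\<bar>vx w j - a\<bar> \<le> 1"
  proof -
    have "(real_of_int m) ^ 2 \<le> 1" using that by (simp add: m_def abs_square_le_1)
    \<comment> \<open>Now the inequality is strict, and integrality gains a whole unit.\<close>
    then have "0 < h" by (simp add: h_def)
    moreover have "\<bar>m\<bar> \<le> 2" using that by (simp add: m_def)
    ultimately have "sqrt 3 * of_int b < sqrt 3 * of_int (vy w j)" using up by linarith
    then show ?thesis by simp
  qed
qed

text \<open>A contact along an arc carried by the circle itself can be moved to the start of that
  arc; a contact with any other arc already occurs at a vertex.\<close>

lemma touching_vertex:
  assumes w: "path_word 0 0 w" and ab: "center_lattice a b" and touch: "sphere (pt a b) 2 \<inter> trace (located w) \<noteq> {}"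
  obtains j where "j \<le> length w" "(vx w j - a) ^ 2 + 3 * (vy w j - b) ^ 2 = 4"
proof -
  have lat: "\<And>i. i < length w \<Longrightarrow> center_lattice (vx w i + cx (w ! i)) (vy w i + cy (w ! i))"
    using w unfolding path_word_iff by simp
  have "\<exists>j\<le>length w. pt (vx w j) (vy w j) \<in> sphere (pt a b) 2"
  proof -
    obtain u where u: "u \<in> sphere (pt a b) 2" "u \<in> trace (located w)" using touch by blast
    show ?thesis
    proof (cases "u = 0")
      case True
      then have "u = pt (vx w 0) (vy w 0)" by (simp add: complex_eq_iff)
      then show ?thesis using u by blast
    next
      case False
      then obtain i where i: "i < length w" "u \<in> arc_from (vx w i) (vy w i) (w ! i)"
        using u(2) by (auto simp: trace_located)
      show ?thesis
      proof (cases "(a, b) = (vx w i + cx (w ! i), vy w i + cy (w ! i))")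
        case True
        have "pt (vx w i) (vy w i) \<in> sphere (pt a b) 2"
          using arc_from_on_circle[OF vertices_in_arc_from(1)[of "vx w i" "vy w i" "w ! i"]] True
          by (simp add: dist_norm cmod_def power2_commute)
        then show ?thesis using i(1) by (intro exI[of _ i]) simp
      next
        case False
        have "u = pt (vx w i) (vy w i) \<or> u = pt (vx w (Suc i)) (vy w (Suc i))"
          using arc_from_touches_at_vertex[OF i(2) lat[OF i(1)] ab u(1) False] by simp
        then show ?thesis using u(1) i(1) by (metis Suc_leI less_imp_le)
      qed
    qed
  qed
  then obtain j where j: "j \<le> length w" "pt (vx w j) (vy w j) \<in> sphere (pt a b) 2" by blast
  have "dist (pt a b) (pt (vx w j) (vy w j)) ^ 2 = 4" using j(2) by simp
  then have "real_of_int ((vx w j - a) ^ 2 + 3 * (vy w j - b) ^ 2) = of_int 4"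
    by (simp add: dist_norm cmod_power2 power2_commute power_mult_distrib flip: right_diff_distrib)
  then have "(vx w j - a) ^ 2 + 3 * (vy w j - b) ^ 2 = 4" by (simp only: of_int_eq_iff)
  then show thesis using that j(1) by blast
qed

text \<open>For \<open>F\<close> this is the circle carrying the arc, for \<open>Ubar\<close> the
  circle with the start of the step at 120 degrees, and for \<open>Dbar\<close> the circle with the
  end of the step at 60 degrees.\<close>

definition perch :: "step list \<Rightarrow> nat \<Rightarrow> complex" where
  "perch w i = (if w ! i = Dbar then pt (vx w i) (vy w i - 2) else pt (vx w i + 1) (vy w i - 1))"

text \<open>The solutions are the six tangency points of a circle, relative to its centre.\<close>

lemma unit_hexagon:
  fixes m n :: int
  assumes "m ^ 2 + 3 * n ^ 2 = 4"
  shows "(\<bar>m\<bar> = 2 \<and> n = 0) \<or> (\<bar>m\<bar> = 1 \<and> \<bar>n\<bar> = 1)"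
proof -
  have "n ^ 2 < 2 * 2" "m ^ 2 < 3 * 3" 
    using assms zero_le_power2[of m] zero_le_power2[of n] by linarith+
  then have "\<bar>n\<bar> < 2" "\<bar>m\<bar> < 3"
    using abs_le_square_iff[of 2 n] abs_le_square_iff[of 3 m] by (simp_all add: power2_eq_square)
  then have "n \<in> {-1, 0, 1}" "m \<in> {-2, -1, 0, 1, 2}" by auto
  then show ?thesis using assms by auto
qed

text \<open>The two lower tangency points would put the path below the circle. From the rightmost
  point one step back, and from the leftmost point one step forward, leads to an upper tangency
  point.\<close>

lemma kissed_circle_near_vertex:
  assumes w: "path_word 0 0 w" and ab: "center_lattice a b" and below: "circle_below (pt a b) (located w)"
    and touch: "sphere (pt a b) 2 \<inter> trace (located w) \<noteq> {}"
  obtains j where "j \<le> length w" "\<bar>vx w j - a\<bar> = 1" "vy w j = b + 1"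
proof -
  have lat: "\<And>i. i < length w \<Longrightarrow> center_lattice (vx w i + cx (w ! i)) (vy w i + cy (w ! i))"
    using w unfolding path_word_iff by simp
  have "even b" using ab by (simp add: center_lattice_def)
  note height = circle_below_vertex_height[OF below]
  obtain j where j: "j \<le> length w" "(vx w j - a) ^ 2 + 3 * (vy w j - b) ^ 2 = 4"
    using touching_vertex[OF w ab touch] .
  then consider "\<bar>vx w j - a\<bar> = 1" "\<bar>vy w j - b\<bar> = 1" | "vx w j = a + 2" "vy w j = b" | "vx w j = a - 2" "vy w j = b"
    using unit_hexagon[OF j(2)] by linarith
  then show thesis
  proof cases
    case 1
    then show ?thesis using height(2)[OF j(1)] that[OF j(1)] by linarith
  next
    case 2
    have "0 \<le> a" using below by (simp add: circle_below_def)
    then obtain i where i: "j = Suc i" using 2 by (cases j) auto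
    have even: "even (vy w i + cy (w ! i))" using lat[of i] i j(1) by (simp add: center_lattice_def)
    have v: "vx w i + dx (w ! i) = a + 2" "vy w i + dy (w ! i) = b" using 2 i by simp_all
    have "dx (w ! i) = 1 \<Longrightarrow> b + 1 \<le> vy w i" using height(2)[of i] v(1) i j(1) by simp
    \<comment> \<open>Parity excludes \<open>F\<close>, \<open>Fbar\<close> and \<open>Dbar\<close>,
      and an ascent would start too low.\<close>
    then have "w ! i = D" using v even \<open>even b\<close> by (cases "w ! i") auto
    then show ?thesis using that[of i] v i j(1) by simp
  next
    case 3
    have "a \<le> vx w (length w)" using below by (simp add: circle_below_def endpoint_located)
    then have "j < length w" using 3 j(1) by (cases "j = length w") auto
    have even: "even (vy w j + cy (w ! j))" using lat[of j] \<open>j < length w\<close> by (simp add: center_lattice_def)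
    have "dx (w ! j) = 1 \<Longrightarrow> b + 1 \<le> vy w (Suc j)" using height(2)[of "Suc j"] 3(1) \<open>j < length w\<close> by simp
    then have "w ! j = U" using 3 even \<open>even b\<close> by (cases "w ! j") auto
    then show ?thesis using that[of "Suc j"] 3 \<open>j < length w\<close> by simp
  qed
qed

lemma kissed_circles:
  assumes w: "path_word 0 0 w"
  shows "{c \<in> packing_centers. circle_below c (located w) \<and> sphere c 2 \<inter> trace (located w) \<noteq> {}} =
    perch w ` {i. i < length w \<and> perching (w ! i)}" (is "?K = ?R")
proof (intro Set.equalityI subsetI)
  have lat: "\<And>i. i < length w \<Longrightarrow> center_lattice (vx w i + cx (w ! i)) (vy w i + cy (w ! i))"
    and vy_end: "vy w (length w) = 0"
    using w unfolding path_word_iff by simp_all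
  {
    fix c assume "c \<in> ?K"
    then obtain a b where c: "c = pt a b" and ab: "center_lattice a b"
      and below: "circle_below (pt a b) (located w)" and touch: "sphere (pt a b) 2 \<inter> trace (located w) \<noteq> {}"
      by (auto simp: packing_centers_eq)
    have "0 \<le> b" using below by (simp add: circle_below_def zero_le_mult_iff)
    have ab': "even b" "4 dvd a - b - 2" using ab by (simp_all add: center_lattice_iff_dvd)
    obtain j where j: "j \<le> length w" "\<bar>vx w j - a\<bar> = 1" "vy w j = b + 1"
      using kissed_circle_near_vertex[OF w ab below touch] .
    then consider "vx w j = a - 1" | "vx w j = a + 1" by linarith
    then have "\<exists>i<length w. perching (w ! i) \<and> perch w i = pt a b"
    proof cases
      case 1
      have "j \<noteq> length w" using j(3) vy_end \<open>0 \<le> b\<close> by auto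
      then have "j < length w" using j(1) by simp
      have "4 dvd vx w j + cx (w ! j) - (vy w j + cy (w ! j)) - 2" "even (vy w j + cy (w ! j))"
        using lat[OF \<open>j < length w\<close>] by (simp_all add: center_lattice_iff_dvd)
      \<comment> \<open>These are the steps that can leave the tangency point at 120
        degrees.\<close>
      then have "w ! j \<in> {F, Ubar}" using ab' 1 j(3) by (cases "w ! j") (auto; presburger)+
      then show ?thesis using \<open>j < length w\<close> 1 j(3) by (auto simp: perch_def perching_def)
    next
      case 2
      have "j \<noteq> 0" using j(3) \<open>0 \<le> b\<close> by (intro notI) simp
      then obtain i where i: "j = Suc i" "i < length w" using j(1) by (cases j) auto
      have v: "vx w i + dx (w ! i) = a + 1" "vy w i + dy (w ! i) = b + 1" using 2 j(3) i by simp_all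
      have "4 dvd vx w i + cx (w ! i) - (vy w i + cy (w ! i)) - 2" "even (vy w i + cy (w ! i))"
        using lat[OF i(2)] by (simp_all add: center_lattice_iff_dvd)
      \<comment> \<open>These are the steps that can arrive at the tangency point at 60
        degrees.\<close>
      then have "w ! i \<in> {F, Dbar}" using ab' v by (cases "w ! i") (auto; presburger)+
      then show ?thesis using i(2) v by (intro exI[of _ i]) (auto simp: perch_def perching_def)
    qed
    then show "c \<in> ?R" using c by force
  }
  {
    fix c assume "c \<in> ?R"
    then obtain i where i: "i < length w" "perching (w ! i)" "c = perch w i" by auto
    have lati: "even (vy w i + cy (w ! i))" "4 dvd vx w i + cx (w ! i) - (vy w i + cy (w ! i)) - 2"
      using lat[OF i(1)] by (simp_all add: center_lattice_iff_dvd)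
    have x: "0 \<le> vx w i" "vx w i + dx (w ! i) \<le> vx w (length w)"
      using vx_mono[of 0 i w] vx_less[OF i(1)] by simp_all
    \<comment> \<open>The contact vertex is the end of the step for \<open>Dbar\<close> and its
      start for \<open>F\<close> and \<open>Ubar\<close>.\<close>
    obtain a b j where c: "c = pt a b" and ab: "center_lattice a b" "0 \<le> a" "a \<le> vx w (length w)"
      and j: "j \<le> length w" "vx w j = a - 1 \<or> vx w j = a + 1" "vy w j = b + 1"
    proof (cases "w ! i = Dbar")
      case True
      have "center_lattice (vx w i) (vy w i - 2)" using lati True by (simp add: center_lattice_iff_dvd)
      then show ?thesis
        using that[of "vx w i" "vy w i - 2" "Suc i"] True i x by (simp add: perch_def)
    next
      case False
      then have s: "w ! i \<in> {F, Ubar}" using i(2) by (auto simp: perching_def)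
      then have "center_lattice (vx w i + 1) (vy w i - 1)" using lati by (auto simp: center_lattice_iff_dvd; presburger)
      then show ?thesis
        using that[of "vx w i + 1" "vy w i - 1" i] s i x by (auto simp: perch_def)
    qed
    have "norm (pt a b - pt (vx w j) (vy w j)) = sqrt (1 + 3)"
      using j(2,3) by (auto simp: cmod_def power_mult_distrib algebra_simps)
    then have "pt (vx w j) (vy w j) \<in> sphere (pt a b) 2" by (simp add: dist_norm)
    then have "sphere (pt a b) 2 \<inter> trace (located w) \<noteq> {}" using vertex_in_trace[OF j(1)] by blast
    then show "c \<in> ?K" using circle_below_near_vertex[OF w ab j] ab(1) c by simp
  }
qed

text \<open>The abscissas of the perches increase strictly. The critical case is \<open>Ubar\<close>
  followed at once by \<open>Dbar\<close>, where both steps would claim the same circle; smoothness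
  forbids this pair.\<close>

lemma inj_on_perch:
  assumes "successively smooth w"
  shows "inj_on (perch w) {i. i < length w \<and> perching (w ! i)}"
proof (rule linorder_inj_onI)
  fix i j assume ij: "i < j" and "i \<in> {i. i < length w \<and> perching (w ! i)}" "j \<in> {i. i < length w \<and> perching (w ! i)}"
  then have i: "perching (w ! i)" and j: "perching (w ! j)" "j < length w" by auto
  have "Re (perch w i) < Re (perch w j)"
  proof (cases "w ! i = Ubar")
    case False
    then show ?thesis using i vx_less[OF ij, of w] by (auto simp: perch_def perching_def)
  next
    case True
    show ?thesis
    proof (cases "j = Suc i")
      case True
      then have "smooth (w ! i) (w ! j)" using assms j(2) by (simp add: successively_conv_nth)
      then show ?thesis using \<open>w ! i = Ubar\<close> True by (simp add: perch_def smooth_def)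
    next
      case False
      then have "Suc i < j" using ij by simp
      from vx_less[OF this, of w] dx_bounds[of "w ! Suc i"] True show ?thesis
        by (auto simp: perch_def)
    qed
  qed
  then show "perch w i \<noteq> perch w j" by auto
qed auto

section \<open>Assembling the generating function\<close>

lemma kiss_located:
  assumes "path_word 0 0 w" "successively smooth w"
  shows "kiss (located w) = length (filter perching w)"
  unfolding kiss_def kissed_circles[OF assms(1)] length_filter_conv_card
  by (rule card_image[OF inj_on_perch[OF assms(2)]])

lemma inchworm_paths_with_kiss:
  "{P. inchworm_path P \<and> kiss P = k} =
    (if k = 0 then {[]} else {}) \<union> (located \<circ> mot_word) ` {t. weight t = k}"
proof -
  have "{P. inchworm_path P \<and> kiss P = k} = {P \<in> {P. inchworm_path P}. kiss P = k}"
    by auto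
  also have "\<dots> = located ` {w. path_word 0 0 w \<and> successively smooth w \<and> length (filter perching w) = k}"
    by (auto simp: inchworm_paths_eq kiss_located)
  also have "{w. path_word 0 0 w \<and> successively smooth w \<and> length (filter perching w) = k} =
      {w \<in> insert [] (range mot_word). length (filter perching w) = k}"
    unfolding path_word_smooth_words[symmetric] by auto
  also have "\<dots> = (if k = 0 then {[]} else {}) \<union> mot_word ` {t. weight t = k}"
  proof -
    have "filter perching (mot_word t) \<noteq> []" for t
      by (metis length_filter_perching_mot_word list.size(3) weight_nonzero)
    then show ?thesis by (auto simp: length_filter_perching_mot_word)
  qed
  finally show ?thesis
    by (auto simp: image_Un image_comp located_def)
qed

theorem corollary12:
  shows "(\<forall>k. finite {P. inchworm_path P \<and> kiss P = k}) \<and>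
    inchworm_gf =
      (1 - fps_X + fps_X ^ 2
         - fps_radical root 2 (1 - 2 * fps_X - fps_X ^ 2 - 2 * fps_X ^ 3 + fps_X ^ 4))
      / (2 * fps_X ^ 2)"
proof
  \<comment> \<open>Since \<open>card\<close> is 0 on infinite sets, finiteness ensures that the
    coefficients of \<open>inchworm_gf\<close> are true counts.\<close>
  show "\<forall>k. finite {P. inchworm_path P \<and> kiss P = k}"
    unfolding inchworm_paths_with_kiss using finite_weight_level by auto
  have "inj located"
    by (metis injI map_snd_located)
  then have "inj (located \<circ> mot_word)"
    using inj_mot_word by (rule inj_compose)
  then have "card ((located \<circ> mot_word) ` S) = card S" for S
    by (intro card_image) (auto intro: inj_on_subset)
  then have "card {P. inchworm_path P \<and> kiss P = k} = (if k = 0 then 1 else card {t. weight t = k})" for k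
    unfolding inchworm_paths_with_kiss by simp
  \<comment> \<open>The summand 1 is the empty path; every tree has positive weight.\<close>
  then have gf: "inchworm_gf = 1 + mot_gf"
    by (intro fps_ext) (simp add: inchworm_gf_def mot_gf_def)
  show "inchworm_gf =
      (1 - fps_X + fps_X ^ 2
         - fps_radical root 2 (1 - 2 * fps_X - fps_X ^ 2 - 2 * fps_X ^ 3 + fps_X ^ 4))
      / (2 * fps_X ^ 2)"
  proof (rule gf_closed_form)
    show "inchworm_gf = 1 + fps_X * inchworm_gf + fps_X ^ 2 * ((inchworm_gf - 1) * inchworm_gf)"
      unfolding gf using mot_gf_eq by simp
  qed
qed

end
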